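(* Let $\kappa$ be an infinite cardinal, $T$ a complete first-order theory with monster model $\mathcal U$, $M\prec\mathcal U$ a model of $T$ and $\phi(x;y)$ an NIP formula, where both $M$ and $T$ have size at most $\kappa$. Let $Z\subseteq \mathrm{Inv}_\phi(M)$ be any subset and assume that $p\in\overline Z$. Then there is a family $(q_i : i\in \mathfrak P_{<\omega}(\kappa))$ of elements of $Z$ with $p=\lim_{\mathfrak F_\kappa} q_i$.
   Context: $\mathcal U$ is a monster model of $T$ (sufficiently saturated and strongly homogeneous), and $M$ is a small elementary submodel. $x$ and $y$ are finite tuples of variables. A formula $\phi(x;y)$ is NIP if there do not exist, in $\mathcal U$, an infinite set $A$ of $|x|$-tuples and, for each $I\subseteq A$, a $|y|$-tuple $b_I$ such that for all $a\in A$: $\mathcal U\models \phi(a;b_I) \iff a\in I$. $S_\phi(\mathcal U)$ is the space of global $\phi$-types, i.e. maximal consistent sets of formulas of the form $\phi(x;b)$ or $\neg\phi(x;b)$, $b\in\mathcal U$, with the topology generated by the sets $\{p:\phi(x;b)\in p\}$ and $\{p:\neg\phi(x;b)\in p\}$. A global $\phi$-type $p$ is $M$-invariant if whenever $b,b'\in\mathcal U$ have the same type over $M$, $p\vdash\phi(x;b)$ if and only if $p\vdash \phi(x;b')$. $\mathrm{Inv}_\phi(M)\subseteq S_\phi(\mathcal U)$ is the space of global $M$-invariant $\phi$-types with the induced topology; $\overline Z$ is the topological closure of $Z$. $\mathfrak P_{<\omega}(\kappa)$ is the set of finite subsets of $\kappa$, and $\mathfrak F_\kappa$ is the filter on $\mathfrak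 P_{<\omega}(\kappa)$ generated by the sets $T_j=\{i\in\mathfrak P_{<\omega}(\kappa) : i\supseteq j\}$, $j\in \mathfrak P_{<\omega}(\kappa)$. For a family $(x_i:i\in\mathfrak P_{<\omega}(\kappa))$ of points in a topological space $Y$ and $x_*\in Y$, we write $x_*=\lim_{\mathfrak F_\kappa}x_i$ if for every neighborhood $U$ of $x_*$ the set $\{i : x_i\in U\}$ belongs to $\mathfrak F_\kappa$. *)

theory Defs
  imports "HOL-Analysis.Analysis"
begin

unbundle cardinal_syntax

section \<open>First-order languages and formulas with parameters\<close>

record ('f, 'r) lang =
  funs :: "'f set"
  rels :: "'r set"
  fun_ar :: "'f \<Rightarrow> nat"
  rel_ar :: "'r \<Rightarrow> nat"

text \<open>
  \<open>Par a\<close> is the constant symbol naming the element \<open>a\<close>: formulas whose parameters lie in \<open>A\<close>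
  are the \<open>L(A)\<close>-formulas, those without parameters are the \<open>L\<close>-formulas.
\<close>

datatype (trm_funs: 'f, trm_params: 'u) trm =
    Var nat
  | Par 'u
  | Fun 'f "('f, 'u) trm list"

datatype (fm_funs: 'f, fm_rels: 'r, params: 'u) fm =
    Eq "('f, 'u) trm" "('f, 'u) trm"
  | Rel 'r "('f, 'u) trm list"
  | Neg "('f, 'r, 'u) fm"
  | And "('f, 'r, 'u) fm" "('f, 'r, 'u) fm"
  | Ex nat "('f, 'r, 'u) fm"

fun wf_trm :: "('f, 'r) lang \<Rightarrow> ('f, 'u) trm \<Rightarrow> bool" where
  "wf_trm L (Var v) \<longleftrightarrow> True"
| "wf_trm L (Par a) \<longleftrightarrow> True"
| "wf_trm L (Fun f ts) \<longleftrightarrow> f \<in> funs L \<and> length ts = fun_ar L f \<and> (\<forall>t\<in>set ts. wf_trm L t)"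

fun wf_fm :: "('f, 'r) lang \<Rightarrow> ('f, 'r, 'u) fm \<Rightarrow> bool" where
  "wf_fm L (Eq s t) \<longleftrightarrow> wf_trm L s \<and> wf_trm L t"
| "wf_fm L (Rel r ts) \<longleftrightarrow> r \<in> rels L \<and> length ts = rel_ar L r \<and> (\<forall>t\<in>set ts. wf_trm L t)"
| "wf_fm L (Neg \<theta>) \<longleftrightarrow> wf_fm L \<theta>"
| "wf_fm L (And \<theta> \<psi>) \<longleftrightarrow> wf_fm L \<theta> \<and> wf_fm L \<psi>"
| "wf_fm L (Ex v \<theta>) \<longleftrightarrow> wf_fm L \<theta>"

fun fv_trm :: "('f, 'u) trm \<Rightarrow> nat set" where
  "fv_trm (Var v) = {v}"
| "fv_trm (Par a) = {}"
| "fv_trm (Fun f ts) = (\<Union>t\<in>set ts. fv_trm t)"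

fun fv :: "('f, 'r, 'u) fm \<Rightarrow> nat set" where
  "fv (Eq s t) = fv_trm s \<union> fv_trm t"
| "fv (Rel r ts) = (\<Union>t\<in>set ts. fv_trm t)"
| "fv (Neg \<theta>) = fv \<theta>"
| "fv (And \<theta> \<psi>) = fv \<theta> \<union> fv \<psi>"
| "fv (Ex v \<theta>) = fv \<theta> - {v}"

text \<open>\<open>L(A)\<close>-formulas with free variables among \<open>V\<close>, and \<open>L(A)\<close>-sentences.\<close>

definition formulas :: "('f, 'r) lang \<Rightarrow> 'u set \<Rightarrow> nat set \<Rightarrow> ('f, 'r, 'u) fm set" where
  "formulas L A V = {\<theta>. wf_fm L \<theta> \<and> params \<theta> \<subseteq> A \<and> fv \<theta> \<subseteq> V}"

abbreviation sentences :: "('f, 'r) lang \<Rightarrow> 'u set \<Rightarrow> ('f, 'r, 'u) fm set" where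
  "sentences L A \<equiv> formulas L A {}"

fun subst_trm :: "(nat \<Rightarrow> 'u option) \<Rightarrow> ('f, 'u) trm \<Rightarrow> ('f, 'u) trm" where
  "subst_trm s (Var v) = (case s v of None \<Rightarrow> Var v | Some a \<Rightarrow> Par a)"
| "subst_trm s (Par a) = Par a"
| "subst_trm s (Fun f ts) = Fun f (map (subst_trm s) ts)"

fun subst :: "(nat \<Rightarrow> 'u option) \<Rightarrow> ('f, 'r, 'u) fm \<Rightarrow> ('f, 'r, 'u) fm" where
  "subst s (Eq t u) = Eq (subst_trm s t) (subst_trm s u)"
| "subst s (Rel r ts) = Rel r (map (subst_trm s) ts)"
| "subst s (Neg \<theta>) = Neg (subst s \<theta>)"
| "subst s (And \<theta> \<psi>) = And (subst s \<theta>) (subst s \<psi>)"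
| "subst s (Ex v \<theta>) = Ex v (subst (s(v := None)) \<theta>)"

text \<open>
  \<open>inst ys b \<theta>\<close> replaces the tuple of variables \<open>ys\<close> by the tuple of parameters \<open>b\<close>;
  so \<open>\<phi>(x;b)\<close> is \<open>inst ys b \<phi>\<close> and \<open>\<phi>(a;b)\<close> is \<open>inst xs a (inst ys b \<phi>)\<close>.
\<close>

definition inst :: "nat list \<Rightarrow> 'u list \<Rightarrow> ('f, 'r, 'u) fm \<Rightarrow> ('f, 'r, 'u) fm" where
  "inst vs a \<theta> = subst (map_of (zip vs a)) \<theta>"


section \<open>Structures and theories\<close>

record ('f, 'r, 'u) struct =
  univ :: "'u set"
  fun_int :: "'f \<Rightarrow> 'u list \<Rightarrow> 'u"
  rel_int :: "'r \<Rightarrow> 'u list \<Rightarrow> bool"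

text \<open>\<open>tuples A n\<close> is \<open>A\<^sup>n\<close>.\<close>

definition tuples :: "'u set \<Rightarrow> nat \<Rightarrow> 'u list set" where
  "tuples A n = {a. set a \<subseteq> A \<and> length a = n}"

definition is_structure :: "('f, 'r) lang \<Rightarrow> ('f, 'r, 'u) struct \<Rightarrow> bool" where
  "is_structure L S \<longleftrightarrow> univ S \<noteq> {} \<and>
     (\<forall>f\<in>funs L. \<forall>a\<in>tuples (univ S) (fun_ar L f). fun_int S f a \<in> univ S)"

fun eval :: "('f, 'r, 'u) struct \<Rightarrow> (nat \<Rightarrow> 'u) \<Rightarrow> ('f, 'u) trm \<Rightarrow> 'u" where
  "eval S e (Var v) = e v"
| "eval S e (Par a) = a"
| "eval S e (Fun f ts) = fun_int S f (map (eval S e) ts)"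

fun sat :: "('f, 'r, 'u) struct \<Rightarrow> (nat \<Rightarrow> 'u) \<Rightarrow> ('f, 'r, 'u) fm \<Rightarrow> bool" where
  "sat S e (Eq s t) \<longleftrightarrow> eval S e s = eval S e t"
| "sat S e (Rel r ts) \<longleftrightarrow> rel_int S r (map (eval S e) ts)"
| "sat S e (Neg \<theta>) \<longleftrightarrow> \<not> sat S e \<theta>"
| "sat S e (And \<theta> \<psi>) \<longleftrightarrow> sat S e \<theta> \<and> sat S e \<psi>"
| "sat S e (Ex v \<theta>) \<longleftrightarrow> (\<exists>a\<in>univ S. sat S (e(v := a)) \<theta>)"

text \<open>
  Truth of a sentence. It is only applied to formulas without free variables, for which the
  quantification over all assignments is immaterial.
\<close>

definition holds :: "('f, 'r, 'u) struct \<Rightarrow> ('f, 'r, 'u) fm \<Rightarrow> bool" where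
  "holds S \<sigma> \<longleftrightarrow> (\<forall>e. range e \<subseteq> univ S \<longrightarrow> sat S e \<sigma>)"

definition is_model :: "('f, 'r) lang \<Rightarrow> ('f, 'r, 'u) struct \<Rightarrow> ('f, 'r, 'u) fm set \<Rightarrow> bool" where
  "is_model L S T \<longleftrightarrow> is_structure L S \<and> (\<forall>\<sigma>\<in>T. holds S \<sigma>)"

text \<open>
  A complete theory is a maximal consistent set of \<open>L\<close>-sentences (so it is deductively closed, and
  its cardinality is that of the set of \<open>L\<close>-formulas, the usual meaning of the size of \<open>T\<close>).
  Consistency is not repeated here: wherever this notion is used, a model of \<open>T\<close> is given.
\<close>

definition complete_theory :: "('f, 'r) lang \<Rightarrow> ('f, 'r, 'u) fm set \<Rightarrow> bool" where
  "complete_theory L T \<longleftrightarrow> T \<subseteq> sentences L {} \<and> (\<forall>\<sigma>\<in>sentences L {}. \<sigma> \<in> T \<or> Neg \<sigma> \<in> T)"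

definition elementary_submodel ::
    "('f, 'r) lang \<Rightarrow> ('f, 'r, 'u) struct \<Rightarrow> ('f, 'r, 'u) struct \<Rightarrow> bool" where
  "elementary_submodel L M U \<longleftrightarrow> is_structure L M \<and> univ M \<subseteq> univ U \<and>
     (\<forall>\<theta>\<in>sentences L (univ M). holds M \<theta> \<longleftrightarrow> holds U \<theta>)"


section \<open>Monster models\<close>

text \<open>\<open>\<mu>\<close>-saturation, for sets of formulas in the single variable \<open>Var 0\<close>.\<close>

definition saturated ::
    "('f, 'r) lang \<Rightarrow> 'm rel \<Rightarrow> ('f, 'r, 'u) struct \<Rightarrow> bool" where
  "saturated L \<mu> U \<longleftrightarrow>
     (\<forall>A \<Sigma>. A \<subseteq> univ U \<and> |A| <o \<mu> \<and> \<Sigma> \<subseteq> formulas L A {0} \<and>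
        (\<forall>F. F \<subseteq> \<Sigma> \<and> finite F \<longrightarrow> (\<exists>a\<in>univ U. \<forall>\<theta>\<in>F. holds U (inst [0] [a] \<theta>))) \<longrightarrow>
        (\<exists>a\<in>univ U. \<forall>\<theta>\<in>\<Sigma>. holds U (inst [0] [a] \<theta>)))"

text \<open>Below, \<open>map_fm id id f\<close> replaces each parameter \<open>a\<close> by \<open>f a\<close>.\<close>

definition partial_elementary ::
    "('f, 'r) lang \<Rightarrow> ('f, 'r, 'u) struct \<Rightarrow> 'u set \<Rightarrow> ('u \<Rightarrow> 'u) \<Rightarrow> bool" where
  "partial_elementary L U A f \<longleftrightarrow> A \<subseteq> univ U \<and> f ` A \<subseteq> univ U \<and>
     (\<forall>\<theta>\<in>sentences L A. holds U \<theta> \<longleftrightarrow> holds U (map_fm id id f \<theta>))"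

definition automorphism ::
    "('f, 'r) lang \<Rightarrow> ('f, 'r, 'u) struct \<Rightarrow> ('u \<Rightarrow> 'u) \<Rightarrow> bool" where
  "automorphism L U g \<longleftrightarrow> bij_betw g (univ U) (univ U) \<and>
     (\<forall>f\<in>funs L. \<forall>a\<in>tuples (univ U) (fun_ar L f). g (fun_int U f a) = fun_int U f (map g a)) \<and>
     (\<forall>r\<in>rels L. \<forall>a\<in>tuples (univ U) (rel_ar L r). rel_int U r a \<longleftrightarrow> rel_int U r (map g a))"

definition strongly_homogeneous ::
    "('f, 'r) lang \<Rightarrow> 'm rel \<Rightarrow> ('f, 'r, 'u) struct \<Rightarrow> bool" where
  "strongly_homogeneous L \<mu> U \<longleftrightarrow>
     (\<forall>A f. |A| <o \<mu> \<and> partial_elementary L U A f \<longrightarrow>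
        (\<exists>g. automorphism L U g \<and> (\<forall>a\<in>A. g a = f a)))"

text \<open>
  \<open>\<mu>\<close> measures the degree of saturation and homogeneity; a set is small if its cardinality
  is \<open>< \<mu>\<close>.
\<close>

definition monster_model ::
    "('f, 'r) lang \<Rightarrow> ('f, 'r, 'u) fm set \<Rightarrow> 'm rel \<Rightarrow> ('f, 'r, 'u) struct \<Rightarrow> bool" where
  "monster_model L T \<mu> U \<longleftrightarrow> is_model L U T \<and> Card_order \<mu> \<and> |T| <o \<mu> \<and>
     saturated L \<mu> U \<and> strongly_homogeneous L \<mu> U"


section \<open>NIP formulas and spaces of \<open>\<phi>\<close>-types\<close>

text \<open>An \<open>L\<close>-formula \<open>\<phi>(x;y)\<close> with its partition of the variables.\<close>

definition partitioned_formula ::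
    "('f, 'r) lang \<Rightarrow> ('f, 'r, 'u) fm \<Rightarrow> nat list \<Rightarrow> nat list \<Rightarrow> bool" where
  "partitioned_formula L \<phi> xs ys \<longleftrightarrow>
     distinct (xs @ ys) \<and> \<phi> \<in> formulas L {} (set xs \<union> set ys)"

definition NIP ::
    "('f, 'r, 'u) struct \<Rightarrow> ('f, 'r, 'u) fm \<Rightarrow> nat list \<Rightarrow> nat list \<Rightarrow> bool" where
  "NIP U \<phi> xs ys \<longleftrightarrow>
     \<not> (\<exists>A b. infinite A \<and> A \<subseteq> tuples (univ U) (length xs) \<and>
          (\<forall>I. I \<subseteq> A \<longrightarrow> b I \<in> tuples (univ U) (length ys) \<and>
             (\<forall>a\<in>A. holds U (inst xs a (inst ys (b I) \<phi>)) \<longleftrightarrow> a \<in> I)))"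

definition phi_formulas ::
    "('f, 'r, 'u) struct \<Rightarrow> ('f, 'r, 'u) fm \<Rightarrow> nat list \<Rightarrow> ('f, 'r, 'u) fm set" where
  "phi_formulas U \<phi> ys =
     (\<Union>b\<in>tuples (univ U) (length ys). {inst ys b \<phi>, Neg (inst ys b \<phi>)})"

text \<open>
  Consistency, over \<open>U\<close>, of a set of formulas in the variables \<open>xs\<close> with parameters in \<open>U\<close>,
  i.e. consistency together with the elementary diagram of \<open>U\<close>.
\<close>

definition consistent ::
    "('f, 'r, 'u) struct \<Rightarrow> nat list \<Rightarrow> ('f, 'r, 'u) fm set \<Rightarrow> bool" where
  "consistent U xs p \<longleftrightarrow>
     (\<forall>F. F \<subseteq> p \<and> finite F \<longrightarrow>
        (\<exists>a\<in>tuples (univ U) (length xs). \<forall>\<theta>\<in>F. holds U (inst xs a \<theta>)))"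

definition phi_types ::
    "('f, 'r, 'u) struct \<Rightarrow> ('f, 'r, 'u) fm \<Rightarrow> nat list \<Rightarrow> nat list \<Rightarrow> ('f, 'r, 'u) fm set set" where
  "phi_types U \<phi> xs ys =
     {p. p \<subseteq> phi_formulas U \<phi> ys \<and> consistent U xs p \<and>
         (\<forall>q. p \<subseteq> q \<and> q \<subseteq> phi_formulas U \<phi> ys \<and> consistent U xs q \<longrightarrow> q = p)}"

definition phi_type_space ::
    "('f, 'r, 'u) struct \<Rightarrow> ('f, 'r, 'u) fm \<Rightarrow> nat list \<Rightarrow> nat list \<Rightarrow> ('f, 'r, 'u) fm set topology" where
  "phi_type_space U \<phi> xs ys =
     topology_generated_by
       (\<Union>b\<in>tuples (univ U) (length ys).
          {{p \<in> phi_types U \<phi> xs ys. inst ys b \<phi> \<in> p},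
           {p \<in> phi_types U \<phi> xs ys. Neg (inst ys b \<phi>) \<in> p}})"

text \<open>\<open>p \<turnstile> \<psi>\<close>, modulo the elementary diagram of \<open>U\<close>.\<close>

definition entails ::
    "('f, 'r, 'u) struct \<Rightarrow> nat list \<Rightarrow> ('f, 'r, 'u) fm set \<Rightarrow> ('f, 'r, 'u) fm \<Rightarrow> bool" where
  "entails U xs p \<psi> \<longleftrightarrow>
     (\<exists>F. F \<subseteq> p \<and> finite F \<and>
        (\<forall>a\<in>tuples (univ U) (length xs).
           (\<forall>\<theta>\<in>F. holds U (inst xs a \<theta>)) \<longrightarrow> holds U (inst xs a \<psi>)))"

text \<open>The complete type of the tuple \<open>b\<close> over \<open>A\<close>, in the variables \<open>ys\<close>.\<close>

definition tp ::
    "('f, 'r) lang \<Rightarrow> ('f, 'r, 'u) struct \<Rightarrow> 'u set \<Rightarrow> nat list \<Rightarrow> 'u list \<Rightarrow> ('f, 'r, 'u) fm set" where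
  "tp L U A ys b = {\<theta> \<in> formulas L A (set ys). holds U (inst ys b \<theta>)}"

definition invariant_phi_types ::
    "('f, 'r) lang \<Rightarrow> ('f, 'r, 'u) struct \<Rightarrow> ('f, 'r, 'u) struct \<Rightarrow>
     ('f, 'r, 'u) fm \<Rightarrow> nat list \<Rightarrow> nat list \<Rightarrow> ('f, 'r, 'u) fm set set" where
  "invariant_phi_types L U M \<phi> xs ys =
     {p \<in> phi_types U \<phi> xs ys.
        \<forall>b\<in>tuples (univ U) (length ys). \<forall>b'\<in>tuples (univ U) (length ys).
          tp L U (univ M) ys b = tp L U (univ M) ys b' \<longrightarrow>
          (entails U xs p (inst ys b \<phi>) \<longleftrightarrow> entails U xs p (inst ys b' \<phi>))}"

definition invariant_phi_type_space ::
    "('f, 'r) lang \<Rightarrow> ('f, 'r, 'u) struct \<Rightarrow> ('f, 'r, 'u) struct \<Rightarrow>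
     ('f, 'r, 'u) fm \<Rightarrow> nat list \<Rightarrow> nat list \<Rightarrow> ('f, 'r, 'u) fm set topology" where
  "invariant_phi_type_space L U M \<phi> xs ys =
     subtopology (phi_type_space U \<phi> xs ys) (invariant_phi_types L U M \<phi> xs ys)"

text \<open>
  The filter on the finite subsets of \<open>\<kappa>\<close> generated by the sets \<open>{i. i \<supseteq> j}\<close>. A cardinal \<open>\<kappa>\<close> is
  given as a cardinal well-order relation, and its underlying set is \<open>Field \<kappa>\<close>.
\<close>

abbreviation fin_filter :: "'k rel \<Rightarrow> 'k set filter" where
  "fin_filter \<kappa> \<equiv> finite_subsets_at_top (Field \<kappa>)"

end

theory Submission
  imports Defs
begin

text \<open>
  For a \<open>\<phi>\<close>-type \<open>q\<close> and a tuple \<open>b\<close> write \<open>q(b)\<close> for the truth value of \<open>\<phi>(x;b) \<in> q\<close>. Convergence of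
  \<open>\<phi>\<close>-types is pointwise convergence of these functions, and for types in \<open>Z\<close> the value \<open>q(b)\<close> depends
  on the type of \<open>b\<close> over \<open>M\<close> only. As \<open>p\<close> lies in the closure of \<open>Z\<close>, some ultrafilter \<open>D\<close> on \<open>Z\<close>
  converges to \<open>p\<close> pointwise. The problem is to replace \<open>D\<close> by a family indexed by the finite subsets of
  \<open>\<kappa>\<close>, although there may be far more than \<open>\<kappa>\<close> tuples \<open>b\<close>, and even more than \<open>\<kappa>\<close> types over \<open>M\<close>.

  Fix a truth value \<open>\<epsilon>\<close> and let \<open>W\<^sub>0\<close> be the set of all tuples \<open>b\<close>. A point \<open>y\<close> of \<open>W\<^sub>n\<close> belongs to
  \<open>W\<^bsub>n+1\<^esub>\<close> if for every \<open>M\<close>-definable set \<open>C\<close> containing \<open>y\<close>, \<open>D\<close>-almost every \<open>q\<close> disagrees with \<open>p\<close> at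
  some point \<open>z \<in> C \<inter> W\<^sub>n\<close> with \<open>p(z) = \<epsilon>\<close>. This is the tower \<open>disputed\<close>.

  NIP forces every point out of the tower (\<open>disputed_exhausted\<close>). Indeed there are tuples
  \<open>a\<^sub>0, a\<^sub>1, \<dots>\<close> such that every point of \<open>W\<^sub>n\<close> has conjugates over \<open>M\<close> on which
  \<open>\<phi>(a\<^sub>0;y), \<dots>, \<phi>(a\<^bsub>n-1\<^esub>;y)\<close> take all \<open>2\<^sup>n\<close> patterns of truth values. To find \<open>a\<^sub>n\<close>, take
  finitely many sets \<open>C\<close> that meet \<open>W\<^bsub>n+1\<^esub>\<close>. In each of them there is a point \<open>z\<close> of \<open>W\<^sub>n\<close> with
  \<open>p(z) = \<epsilon>\<close>; almost every \<open>q\<close> agrees with \<open>p\<close> at these points, and has a value other than \<open>\<epsilon>\<close>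
  at some other point of \<open>C \<inter> W\<^sub>n\<close>. So a single \<open>q\<close> takes both values on \<open>C \<inter> W\<^sub>n\<close> for each of the chosen
  \<open>C\<close>. It takes the same values on all conjugates over \<open>M\<close>, in particular on those which realise the
  \<open>2\<^sup>n\<close> patterns, and a tuple \<open>a\<^sub>n\<close> that realises \<open>q\<close> on these finitely many conjugates doubles the number of
  patterns. Saturation gives one \<open>a\<^sub>n\<close> for all \<open>C\<close> at once (\<open>shatters_Suc\<close>). A point lying in all
  \<open>W\<^sub>n\<close> would make \<open>{a\<^sub>0, a\<^sub>1, \<dots>}\<close> an infinite independent set.

  Consequently a tuple \<open>b\<close> with \<open>p(b) = \<epsilon>\<close> lies in some \<open>W\<^sub>n\<close> but not in \<open>W\<^bsub>n+1\<^esub>\<close>: it has a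
  neighbourhood \<open>C\<close> such that almost every \<open>q\<close> is good for \<open>(C, n, \<epsilon>)\<close>, meaning that \<open>q\<close> agrees with \<open>p\<close> at
  all points of \<open>C \<inter> W\<^sub>n\<close> where \<open>p\<close> has value \<open>\<epsilon>\<close>, and \<open>b\<close> is one of these points. There
  are at most \<open>\<kappa>\<close> triples \<open>(C, n, \<epsilon>)\<close>, because there are at most \<open>\<kappa>\<close> formulas over \<open>M\<close>; code them by
  elements of \<open>\<kappa>\<close>, and let \<open>q\<^sub>i\<close> be good for all those triples with code in \<open>i\<close> for which almost
  every \<open>q\<close> is good. Then \<open>q\<^sub>i(b) = p(b)\<close> as soon as \<open>i\<close> contains the code of one suitable triple
  (\<open>approximating_family\<close>).
\<close>

section \<open>Substitution and definability\<close>

definition override :: "(nat \<Rightarrow> 'u option) \<Rightarrow> (nat \<Rightarrow> 'u) \<Rightarrow> nat \<Rightarrow> 'u" where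
  "override s e v = (case s v of None \<Rightarrow> e v | Some a \<Rightarrow> a)"

lemma eval_cong: "(\<And>v. v \<in> fv_trm t \<Longrightarrow> e v = e' v) \<Longrightarrow> eval S e t = eval S e' t"
proof (induction t)
  case (Fun f ts)
  then have "map (eval S e) ts = map (eval S e') ts" by auto
  then show ?case by (metis eval.simps(3))
qed auto

lemma sat_cong: "(\<And>v. v \<in> fv \<theta> \<Longrightarrow> e v = e' v) \<Longrightarrow> sat S e \<theta> = sat S e' \<theta>"
proof (induction \<theta> arbitrary: e e')
  case (Eq s t)
  then show ?case using eval_cong[of s e e' S] eval_cong[of t e e' S] by simp
next
  case (Rel r ts)
  then have "map (eval S e) ts = map (eval S e') ts" by (auto intro!: eval_cong)
  then show ?case by (metis sat.simps(2))
next
  case (Neg \<theta>)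
  then show ?case by (metis fv.simps(3) sat.simps(3))
next
  case (And \<theta> \<psi>)
  then show ?case by (metis UnCI fv.simps(4) sat.simps(4))
next
  case (Ex v \<theta>)
  have "sat S (e(v := a)) \<theta> = sat S (e'(v := a)) \<theta>" for a
    using Ex.prems by (intro Ex.IH) auto
  then show ?case by simp
qed

lemma eval_subst: "eval S e (subst_trm s t) = eval S (override s e) t"
proof (induction t)
  case (Fun f ts)
  then have "map (eval S e) (map (subst_trm s) ts) = map (eval S (override s e)) ts" by simp
  then show ?case by (metis eval.simps(3) subst_trm.simps(3))
qed (auto simp: override_def split: option.split)

lemma sat_subst: "sat S e (subst s \<theta>) = sat S (override s e) \<theta>"
proof (induction \<theta> arbitrary: s e)
  case (Rel r ts)
  have "map (eval S e) (map (subst_trm s) ts) = map (eval S (override s e)) ts"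
    by (simp add: eval_subst)
  then show ?case by (metis sat.simps(2) subst.simps(2))
next
  case (Ex v \<theta>)
  have "override (s(v := None)) (e(v := a)) = (override s e)(v := a)" for a
    by (auto simp: override_def fun_eq_iff split: option.split)
  then show ?case by (simp only: subst.simps sat.simps Ex.IH)
qed (auto simp: eval_subst)

lemma fv_subst_trm: "fv_trm (subst_trm s t) = fv_trm t - dom s"
  by (induction t) (auto split: option.splits)

lemma fv_subst: "fv (subst s \<theta>) = fv \<theta> - dom s"
  by (induction \<theta> arbitrary: s) (auto simp: fv_subst_trm)

lemma params_subst_trm: "trm_params (subst_trm s t) \<subseteq> trm_params t \<union> ran s"
proof (induction t)
  case (Fun f ts)
  then show ?case by fastforce
qed (auto split: option.splits intro: ranI)

lemma params_subst: "params (subst s \<theta>) \<subseteq> params \<theta> \<union> ran s"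
proof (induction \<theta> arbitrary: s)
  case (Eq t u)
  then show ?case using params_subst_trm[of s t] params_subst_trm[of s u] by auto
next
  case (Rel r ts)
  then show ?case using params_subst_trm[of s] by fastforce
next
  case (Ex v \<theta>)
  have "ran (s(v := None)) \<subseteq> ran s" by (auto simp: ran_def)
  with Ex[of "s(v := None)"] have "params (subst (s(v := None)) \<theta>) \<subseteq> params \<theta> \<union> ran s" by blast
  then show ?case by simp
qed fastforce+

lemma wf_subst_trm: "wf_trm L t \<Longrightarrow> wf_trm L (subst_trm s t)"
  by (induction t) (auto split: option.splits)

lemma wf_subst: "wf_fm L \<theta> \<Longrightarrow> wf_fm L (subst s \<theta>)"
  by (induction \<theta> arbitrary: s) (auto simp: wf_subst_trm)

lemma subst_in_formulas:
  assumes "\<theta> \<in> formulas L A V"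
  shows "subst s \<theta> \<in> formulas L (A \<union> ran s) (V - dom s)"
  using assms params_subst[of s \<theta>] by (auto simp: formulas_def wf_subst fv_subst)

text \<open>
  Together with \<open>tuple_as_map\<close> below, this turns statements about tuples of parameters into statements about
  assignments, the form in which definable sets and types are handled from here on.
\<close>

lemma holds_inst_iff:
  assumes "fv \<theta> \<subseteq> set vs" "range e \<subseteq> univ S"
  shows "holds S (inst vs (map e vs) \<theta>) \<longleftrightarrow> sat S e \<theta>"
proof -
  have "sat S e' (inst vs (map e vs) \<theta>) = sat S e \<theta>" for e'
    unfolding inst_def sat_subst
    by (rule sat_cong) (use assms in \<open>auto simp: override_def map_of_zip_map\<close>)
  then show ?thesis using assms(2) by (auto simp: holds_def)
qed

lemma tuple_as_map:
  fixes vs :: "nat list"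
  assumes "a \<in> tuples A (length vs)" "distinct vs" "A \<noteq> {}"
  obtains e where "range e \<subseteq> A" "map e vs = a"
proof -
  obtain c where c: "c \<in> A" using assms by blast
  let ?e = "override (map_of (zip vs a)) (\<lambda>_. c)"
  have len: "length a = length vs" and sub: "set a \<subseteq> A" using assms by (auto simp: tuples_def)
  have "range ?e \<subseteq> A"
    using sub c by (auto simp: override_def split: option.splits dest!: map_of_SomeD set_zip_rightD)
  moreover have "map ?e vs = a"
    using len assms(2)
    by (auto intro!: nth_equalityI simp: override_def map_of_zip_nth)
  ultimately show ?thesis using that by blast
qed


text \<open>
  Definability is a property of predicates on assignments: once closure under the logical operations is
  established, partial types can be given by their meaning instead of by explicit formulas.
\<close>

definition definable ::
    "('f, 'r) lang \<Rightarrow> ('f, 'r, 'u) struct \<Rightarrow> 'u set \<Rightarrow> nat set \<Rightarrow> ((nat \<Rightarrow> 'u) \<Rightarrow> bool) \<Rightarrow> bool" where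
  "definable L S A V P \<longleftrightarrow>
     (\<exists>\<theta>\<in>formulas L A V. \<forall>e. range e \<subseteq> univ S \<longrightarrow> (sat S e \<theta> \<longleftrightarrow> P e))"

lemma definableI:
  "\<theta> \<in> formulas L A V \<Longrightarrow> (\<And>e. range e \<subseteq> univ S \<Longrightarrow> sat S e \<theta> \<longleftrightarrow> P e) \<Longrightarrow> definable L S A V P"
  by (auto simp: definable_def)

lemma definable_cong:
  assumes "definable L S A V P" "range e \<subseteq> univ S" "range e' \<subseteq> univ S" "\<And>v. v \<in> V \<Longrightarrow> e v = e' v"
  shows "P e \<longleftrightarrow> P e'"
proof -
  obtain \<theta> where \<theta>: "\<theta> \<in> formulas L A V" "\<forall>e. range e \<subseteq> univ S \<longrightarrow> (sat S e \<theta> \<longleftrightarrow> P e)"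
    using assms(1) unfolding definable_def by blast
  have "sat S e \<theta> = sat S e' \<theta>"
    by (rule sat_cong) (use \<theta>(1) assms(4) in \<open>auto simp: formulas_def\<close>)
  with \<theta>(2) assms show ?thesis by blast
qed

lemma definable_mono:
  "definable L S A V P \<Longrightarrow> A \<subseteq> B \<Longrightarrow> V \<subseteq> W \<Longrightarrow> definable L S B W P"
  unfolding definable_def formulas_def by blast

lemma definable_equiv:
  "definable L S A V P \<Longrightarrow> (\<And>e. range e \<subseteq> univ S \<Longrightarrow> P e \<longleftrightarrow> Q e) \<Longrightarrow> definable L S A V Q"
  unfolding definable_def by blast

lemma definable_eq: "v \<in> V \<Longrightarrow> w \<in> V \<Longrightarrow> definable L S A V (\<lambda>e. e v = e w)"
  by (rule definableI[of "Eq (Var v) (Var w)"]) (auto simp: formulas_def)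

lemma definable_not: "definable L S A V P \<Longrightarrow> definable L S A V (\<lambda>e. \<not> P e)"
  unfolding definable_def
  by (elim bexE, rule_tac x="Neg \<theta>" in bexI) (auto simp: formulas_def)

lemma definable_and:
  "definable L S A V P \<Longrightarrow> definable L S A V Q \<Longrightarrow> definable L S A V (\<lambda>e. P e \<and> Q e)"
  unfolding definable_def
  by (elim bexE, rule_tac x="And \<theta> \<theta>'" in bexI) (auto simp: formulas_def)

lemma definable_True: "definable L S A V (\<lambda>e. True)"
proof (cases "univ S = {}")
  case True
  then show ?thesis
    by (intro definableI[of "Neg (Ex 0 (Eq (Var 0) (Var 0)))"]) (auto simp: formulas_def)
next
  case False
  then show ?thesis
    by (intro definableI[of "Ex 0 (Eq (Var 0) (Var 0))"]) (auto simp: formulas_def)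
qed

lemma definable_iff_const: "definable L S A V P \<Longrightarrow> definable L S A V (\<lambda>e. P e = c)"
  by (cases c) (simp_all add: definable_not)

lemma definable_ball:
  "finite I \<Longrightarrow> (\<And>i. i \<in> I \<Longrightarrow> definable L S A V (P i)) \<Longrightarrow> definable L S A V (\<lambda>e. \<forall>i\<in>I. P i e)"
  by (induction I rule: finite_induct) (simp_all add: definable_True definable_and)

lemma definable_ex1:
  assumes "definable L S A V P"
  shows "definable L S A (V - {v}) (\<lambda>e. \<exists>a\<in>univ S. P (e(v := a)))"
proof -
  obtain \<theta> where \<theta>: "\<theta> \<in> formulas L A V" "\<And>e. range e \<subseteq> univ S \<Longrightarrow> sat S e \<theta> \<longleftrightarrow> P e"
    using assms unfolding definable_def by blast
  show ?thesis
  proof (rule definableI[of "Ex v \<theta>"])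
    show "Ex v \<theta> \<in> formulas L A (V - {v})" using \<theta>(1) by (auto simp: formulas_def)
    fix e :: "nat \<Rightarrow> 'c" assume e: "range e \<subseteq> univ S"
    then have "range (e(v := a)) \<subseteq> univ S" if "a \<in> univ S" for a using that by auto
    then show "sat S e (Ex v \<theta>) \<longleftrightarrow> (\<exists>a\<in>univ S. P (e(v := a)))" using \<theta>(2) by simp
  qed
qed

lemma definable_ex:
  assumes "finite W" "definable L S A V P"
  shows "definable L S A (V - W)
    (\<lambda>e. \<exists>e'. range e' \<subseteq> univ S \<and> (\<forall>v. v \<notin> W \<longrightarrow> e' v = e v) \<and> P e')"
  using assms(1)
proof (induction W rule: finite_induct)
  case empty
  have "P e \<longleftrightarrow> (\<exists>e'. range e' \<subseteq> univ S \<and> (\<forall>v. v \<notin> {} \<longrightarrow> e' v = e v) \<and> P e')"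
    if "range e \<subseteq> univ S" for e
  proof
    assume "P e"
    then show "\<exists>e'. range e' \<subseteq> univ S \<and> (\<forall>v. v \<notin> {} \<longrightarrow> e' v = e v) \<and> P e'"
      using that by (intro exI[of _ e]) simp
  next
    assume "\<exists>e'. range e' \<subseteq> univ S \<and> (\<forall>v. v \<notin> {} \<longrightarrow> e' v = e v) \<and> P e'"
    then obtain e' where "\<forall>v. v \<notin> {} \<longrightarrow> e' v = e v" "P e'" by blast
    moreover from this have "e' = e" by (intro ext) simp
    ultimately show "P e" by simp
  qed
  from definable_equiv[OF assms(2) this] show ?case by (simp only: Diff_empty)
next
  case (insert w W)
  let ?E = "\<lambda>W e. \<exists>e'. range e' \<subseteq> univ S \<and> (\<forall>v. v \<notin> W \<longrightarrow> e' v = e v) \<and> P e'"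
  have "definable L S A (V - W - {w}) (?E (insert w W))"
  proof (rule definable_equiv[OF definable_ex1[OF insert.IH]])
    fix e :: "nat \<Rightarrow> 'c" assume e: "range e \<subseteq> univ S"
    show "(\<exists>a\<in>univ S. ?E W (e(w := a))) \<longleftrightarrow> ?E (insert w W) e"
    proof
      assume "\<exists>a\<in>univ S. ?E W (e(w := a))"
      then obtain a e' where "range e' \<subseteq> univ S" "\<forall>v. v \<notin> W \<longrightarrow> e' v = (e(w := a)) v" "P e'" by blast
      then show "?E (insert w W) e" by (intro exI[of _ e']) auto
    next
      assume "?E (insert w W) e"
      then obtain e' where e': "range e' \<subseteq> univ S" "\<forall>v. v \<notin> insert w W \<longrightarrow> e' v = e v" "P e'" by blast
      then have "?E W (e(w := e' w))" by (intro exI[of _ e']) auto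
      then show "\<exists>a\<in>univ S. ?E W (e(w := a))" using e'(1) by blast
    qed
  qed
  then show ?case unfolding Diff_insert[of V w W] .
qed

lemma definable_subst:
  assumes "definable L S A V P" "ran s \<subseteq> univ S"
  shows "definable L S (A \<union> ran s) (V - dom s) (\<lambda>e. P (override s e))"
proof -
  obtain \<theta> where \<theta>: "\<theta> \<in> formulas L A V" "\<And>e. range e \<subseteq> univ S \<Longrightarrow> sat S e \<theta> \<longleftrightarrow> P e"
    using assms unfolding definable_def by blast
  show ?thesis
  proof (rule definableI[OF subst_in_formulas[OF \<theta>(1)]])
    fix e :: "nat \<Rightarrow> 'c" assume "range e \<subseteq> univ S"
    then have "override s e v \<in> univ S" for v
      using assms(2) by (cases "s v") (auto simp: override_def dest: ranI)
    then have "range (override s e) \<subseteq> univ S" by auto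
    then show "sat S e (subst s \<theta>) \<longleftrightarrow> P (override s e)" using \<theta>(2) by (simp add: sat_subst)
  qed
qed


section \<open>Saturation in several variables\<close>

lemma saturatedD:
  assumes "saturated L \<mu> U" "A \<subseteq> univ U" "|A| <o \<mu>" "\<Sigma> \<subseteq> formulas L A {0}"
    and "\<And>F. F \<subseteq> \<Sigma> \<Longrightarrow> finite F \<Longrightarrow> \<exists>a\<in>univ U. \<forall>\<theta>\<in>F. holds U (inst [0] [a] \<theta>)"
  shows "\<exists>a\<in>univ U. \<forall>\<theta>\<in>\<Sigma>. holds U (inst [0] [a] \<theta>)"
  using assms(1)[unfolded saturated_def, rule_format, of A \<Sigma>] assms(2-) by simp

text \<open>
  Saturation for types in finitely many variables follows from the one-variable case by realising one
  variable at a time and turning it into a parameter. Saturation refers to the variable \<open>0\<close>; so if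
  \<open>0\<close> is among the variables it is realised first, and otherwise a variable \<open>v\<close> is passed to the fresh
  variable \<open>0\<close> through the equation \<open>v = 0\<close> under the quantifiers, which avoids renaming.
\<close>

lemma saturated_finite_variables:
  assumes sat: "saturated L \<mu> U" and ne: "univ U \<noteq> {}" and \<mu>: "Cinfinite \<mu>"
    and "finite V" "A \<subseteq> univ U" "|A| <o \<mu>"
    and "\<And>P. P \<in> \<P> \<Longrightarrow> definable L U A V P"
    and "\<And>F. F \<subseteq> \<P> \<Longrightarrow> finite F \<Longrightarrow> \<exists>e. range e \<subseteq> univ U \<and> (\<forall>P\<in>F. P e)"
  shows "\<exists>e. range e \<subseteq> univ U \<and> (\<forall>P\<in>\<P>. P e)"
  using assms(4-)
proof (induction "card V" arbitrary: V A \<P>)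
  case 0
  then have V: "V = {}" by simp
  obtain c where c: "c \<in> univ U" using ne by blast
  have "P (\<lambda>_. c)" if P: "P \<in> \<P>" for P
  proof -
    obtain e where "range e \<subseteq> univ U" "P e" using 0(6)[of "{P}"] P by auto
    then show ?thesis using definable_cong[OF 0(5)[OF P], of e "\<lambda>_. c"] c V by auto
  qed
  then show ?case using c by (intro exI[of _ "\<lambda>_. c"]) auto
next
  case (Suc n)
  have "\<exists>v. v \<in> V \<and> (0 \<in> V \<longrightarrow> v = 0)" using Suc(2) by (cases "0 \<in> V") (auto, metis card.empty ex_in_conv nat.distinct(1))
  then obtain v where v: "v \<in> V" "0 \<in> V \<longrightarrow> v = 0" by blast
  \<comment> \<open>\<open>Q F\<close>, as a condition on the value of the variable \<open>0\<close>: this value for \<open>v\<close> extends to a solution of \<open>F\<close>\<close>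
  define Q where "Q F e \<longleftrightarrow> (\<exists>e'. range e' \<subseteq> univ U \<and> (\<forall>u. u \<notin> V - {0} \<longrightarrow> e' u = e u) \<and>
     (e' v = e' 0 \<and> (\<forall>P\<in>F. P e')))" for F e
  have "definable L U A {0} (Q F)" if F: "F \<subseteq> \<P>" "finite F" for F
  proof -
    have "definable L U A (insert 0 V) (\<lambda>e. e v = e 0 \<and> (\<forall>P\<in>F. P e))"
      using F Suc.prems(4) v
      by (intro definable_and definable_eq definable_ball) (auto intro: definable_mono)
    from definable_ex[OF _ this, of "V - {0}"] Suc.prems(1)
    have "definable L U A (insert 0 V - (V - {0})) (Q F)" unfolding Q_def by simp
    then show ?thesis by (rule definable_mono) auto
  qed
  then have "\<forall>F. F \<subseteq> \<P> \<and> finite F \<longrightarrow> (\<exists>\<theta>. \<theta> \<in> formulas L A {0} \<and>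
      (\<forall>e. range e \<subseteq> univ U \<longrightarrow> (sat U e \<theta> \<longleftrightarrow> Q F e)))"
    unfolding definable_def by blast
  then obtain \<theta> where \<theta>: "\<And>F. F \<subseteq> \<P> \<Longrightarrow> finite F \<Longrightarrow> \<theta> F \<in> formulas L A {0}"
    "\<And>F e. F \<subseteq> \<P> \<Longrightarrow> finite F \<Longrightarrow> range e \<subseteq> univ U \<Longrightarrow> sat U e (\<theta> F) \<longleftrightarrow> Q F e"
    by metis
  have holds: "holds U (inst [0] [a] (\<theta> F)) \<longleftrightarrow> Q F (\<lambda>_. a)"
    if "F \<subseteq> \<P>" "finite F" "a \<in> univ U" for F a
    using holds_inst_iff[of "\<theta> F" "[0]" "\<lambda>_. a" U] \<theta>(1)[of F] \<theta>(2)[of F "\<lambda>_. a"] that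
    by (auto simp: formulas_def)
  let ?\<Sigma> = "\<theta> ` {F. F \<subseteq> \<P> \<and> finite F}"
  have fin: "\<exists>a\<in>univ U. \<forall>\<psi>\<in>G. holds U (inst [0] [a] \<psi>)" if "G \<subseteq> ?\<Sigma>" "finite G" for G
  proof -
    obtain \<F> where \<F>: "finite \<F>" "\<F> \<subseteq> {F. F \<subseteq> \<P> \<and> finite F}" "G = \<theta> ` \<F>"
      using finite_subset_image[OF \<open>finite G\<close> \<open>G \<subseteq> ?\<Sigma>\<close>] by blast
    have un: "\<Union>\<F> \<subseteq> \<P>" "finite (\<Union>\<F>)" using \<F> by auto
    obtain e where e: "range e \<subseteq> univ U" "\<forall>P\<in>\<Union>\<F>. P e"
      using Suc.prems(5)[OF un] by metis
    have ev: "e v \<in> univ U" using e by auto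
    let ?e = "e(0 := e v)"
    have e': "range ?e \<subseteq> univ U" using e(1) ev by auto
    have "Q F (\<lambda>_. e v)" if "F \<in> \<F>" for F
    proof -
      have "P ?e" if "P \<in> F" for P
      proof -
        have "P \<in> \<P>" "P e" using \<F> \<open>F \<in> \<F>\<close> e that by auto
        moreover have "e u = ?e u" if "u \<in> V" for u using v that by auto
        ultimately show ?thesis using definable_cong[OF Suc.prems(4) e(1) e', of P] by blast
      qed
      \<comment> \<open>outside \<open>V\<close> the assignment has to agree with the constant one\<close>
      moreover define e'' where "e'' u = (if u \<in> V then ?e u else e v)" for u
      have r: "range e'' \<subseteq> univ U" using e' ev by (auto simp: e''_def)
      ultimately have "P e''" if "P \<in> F" for P
        using definable_cong[OF Suc.prems(4) r e', of P] \<F> \<open>F \<in> \<F>\<close> that by (auto simp: e''_def)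
      then show ?thesis unfolding Q_def using r v by (intro exI[of _ e'']) (auto simp: e''_def)
    qed
    then show ?thesis using holds[OF _ _ ev] \<F> ev by (intro bexI[of _ "e v"]) auto
  qed
  have sub: "?\<Sigma> \<subseteq> formulas L A {0}" using \<theta>(1) by auto
  obtain a where a: "a \<in> univ U" "\<forall>\<psi>\<in>?\<Sigma>. holds U (inst [0] [a] \<psi>)"
    by (rule bexE[OF saturatedD[OF sat Suc.prems(2,3) sub fin]])
  have Qa: "Q F (\<lambda>_. a)" if "F \<subseteq> \<P>" "finite F" for F
  proof -
    have "holds U (inst [0] [a] (\<theta> F))" by (rule bspec[OF a(2)]) (use that in simp)
    then show ?thesis using holds[OF that a(1)] by simp
  qed
  have s: "override [v \<mapsto> a] e = e(v := a)" for e by (auto simp: override_def)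
  have "\<exists>e. range e \<subseteq> univ U \<and> (\<forall>P\<in>(\<lambda>P e. P (e(v := a))) ` \<P>. P e)"
  proof (rule Suc.hyps(1)[of "V - {v}" "A \<union> {a}"])
    show "n = card (V - {v})" using Suc(2) v(1) by simp
    show "finite (V - {v})" "A \<union> {a} \<subseteq> univ U" using Suc.prems a by auto
    show "|A \<union> {a}| <o \<mu>"
      using Suc.prems(3) \<mu>
      by (intro Un_Cinfinite_bound_strict Cfinite_ordLess_Cinfinite[of "|{a}|"])
        (simp_all add: cfinite_def card_of_card_order_on Field_card_of)
  next
    fix P' assume "P' \<in> (\<lambda>P e. P (e(v := a))) ` \<P>"
    then obtain P where P: "P \<in> \<P>" "P' = (\<lambda>e. P (e(v := a)))" by blast
    show "definable L U (A \<union> {a}) (V - {v}) P'"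
      using definable_subst[OF Suc.prems(4)[OF P(1)], of "[v \<mapsto> a]"] a(1) by (simp add: P(2) s)
  next
    fix F' assume F': "F' \<subseteq> (\<lambda>P e. P (e(v := a))) ` \<P>" "finite F'"
    obtain F where F: "finite F" "F \<subseteq> \<P>" "F' = (\<lambda>P e. P (e(v := a))) ` F"
      using finite_subset_image[OF F'(2,1)] by blast
    obtain e where e: "range e \<subseteq> univ U" "\<forall>u. u \<notin> V - {0} \<longrightarrow> e u = a" "e v = e 0" "\<forall>P\<in>F. P e"
      using Qa[OF F(2,1)] unfolding Q_def by auto
    have "e(v := a) = e" using e(2,3) by auto
    then have "\<forall>P\<in>F'. P e" unfolding F(3) using e(4) by simp
    with e(1) show "\<exists>e. range e \<subseteq> univ U \<and> (\<forall>P\<in>F'. P e)" by (intro exI conjI)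
  qed
  then obtain e where "range e \<subseteq> univ U" "\<forall>P\<in>\<P>. P (e(v := a))" by auto
  then show ?case using a(1) by (intro exI[of _ "e(v := a)"]) auto
qed

lemma saturated_family:
  assumes "saturated L \<mu> U" "univ U \<noteq> {}" "Cinfinite \<mu>" "finite V" "A \<subseteq> univ U" "|A| <o \<mu>"
    and def: "\<And>i. i \<in> I \<Longrightarrow> definable L U A V (P i)"
    and fin: "\<And>F. F \<subseteq> I \<Longrightarrow> finite F \<Longrightarrow> \<exists>e. range e \<subseteq> univ U \<and> (\<forall>i\<in>F. P i e)"
  shows "\<exists>e. range e \<subseteq> univ U \<and> (\<forall>i\<in>I. P i e)"
proof -
  have "\<exists>e. range e \<subseteq> univ U \<and> (\<forall>Q\<in>P ` I. Q e)"
  proof (rule saturated_finite_variables[OF assms(1-6)])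
    fix F assume "F \<subseteq> P ` I" "finite F"
    then obtain G where G: "finite G" "G \<subseteq> I" "F = P ` G" using finite_subset_image by metis
    show "\<exists>e. range e \<subseteq> univ U \<and> (\<forall>Q\<in>F. Q e)" using fin[OF G(2,1)] unfolding G(3) by simp
  qed (use def in auto)
  then show ?thesis by simp
qed


section \<open>Counting formulas\<close>

lemma card_image_bound: "|A| \<le>o r \<Longrightarrow> |f ` A| \<le>o r"
  using card_of_image ordLeq_transitive by blast

lemma card_subset_bound: "A \<subseteq> B \<Longrightarrow> |B| \<le>o r \<Longrightarrow> |A| \<le>o r"
  using card_of_mono1 ordLeq_transitive by blast

lemma card_Times_bound: "Cinfinite r \<Longrightarrow> |A| \<le>o r \<Longrightarrow> |B| \<le>o r \<Longrightarrow> |A \<times> B| \<le>o r"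
  by (intro card_of_Times_ordLeq_infinite_Field) (auto simp: cinfinite_def)

lemma card_finite_bound: "Cinfinite r \<Longrightarrow> finite A \<Longrightarrow> |A| \<le>o r"
  by (rule ordLess_imp_ordLeq, rule Cfinite_ordLess_Cinfinite)
     (simp_all add: cfinite_def card_of_card_order_on Field_card_of)

lemma card_nat_bound: "Cinfinite r \<Longrightarrow> |A :: nat set| \<le>o r"
  by (rule card_subset_bound[OF subset_UNIV])
     (use card_of_nat natLeq_ordLeq_cinfinite ordIso_ordLeq_trans in blast)

lemma card_lists_bound:
  assumes r: "Cinfinite r" and A: "|A| \<le>o r"
  shows "|{xs. set xs \<subseteq> A}| \<le>o r"
proof -
  have len: "|{xs. set xs \<subseteq> A \<and> length xs = n}| \<le>o r" for n
  proof (induction n)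
    case 0
    have "finite {xs. set xs \<subseteq> A \<and> length xs = 0}" by (rule finite_subset[of _ "{[]}"]) auto
    then show ?case by (rule card_finite_bound[OF r])
  next
    case (Suc n)
    have "{xs. set xs \<subseteq> A \<and> length xs = Suc n} \<subseteq>
        (\<lambda>(x, xs). x # xs) ` (A \<times> {xs. set xs \<subseteq> A \<and> length xs = n})"
      by (force simp: length_Suc_conv image_iff)
    then show ?case
      by (rule card_subset_bound) (intro card_image_bound card_Times_bound r A Suc)
  qed
  have "|\<Union>n. {xs. set xs \<subseteq> A \<and> length xs = n}| \<le>o r"
    using len by (intro UNION_Cinfinite_bound card_nat_bound r) auto
  then show ?thesis by (rule card_subset_bound[rotated]) auto
qed

text \<open>
  A term of size at most \<open>n\<close> is a variable, a parameter, or a function symbol with a list of terms of size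
  less than \<open>n\<close>, so the bound passes from one size to the next; \<open>card_formulas_bound\<close> is the same argument.
\<close>

lemma card_terms_bound:
  assumes r: "Cinfinite r" and "|funs L| \<le>o r" "|A| \<le>o r"
  shows "|{t. wf_trm L t \<and> trm_params t \<subseteq> A}| \<le>o r"
proof -
  let ?T = "\<lambda>n. {t. wf_trm L t \<and> trm_params t \<subseteq> A \<and> size t < n}"
  have size: "|?T n| \<le>o r" for n
  proof (induction n)
    case 0
    show ?case using card_finite_bound[OF r finite.emptyI] by simp
  next
    case (Suc n)
    let ?S = "range Var \<union> Par ` A \<union> (\<lambda>(f, ts). Fun f ts) ` (funs L \<times> {ts. set ts \<subseteq> ?T n})"
    have "t \<in> ?S" if t: "t \<in> ?T (Suc n)" for t
    proof (cases t)
      case (Fun f ts)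
      have "size s < n" if "s \<in> set ts" for s
        using t that size_list_estimation'[of s ts "size s" size] by (simp add: Fun)
      then have "ts \<in> {ts. set ts \<subseteq> ?T n}" "f \<in> funs L" using t by (fastforce simp: Fun)+
      then show ?thesis unfolding Fun by (intro UnI2 image_eqI[of _ _ "(f, ts)"]) auto
    qed (use t in auto)
    then have "?T (Suc n) \<subseteq> ?S" by blast
    then show ?case
      by (rule card_subset_bound)
        (intro Un_Cinfinite_bound card_image_bound card_Times_bound card_lists_bound card_nat_bound r assms Suc)
  qed
  have "|\<Union>n. ?T n| \<le>o r" using size by (intro UNION_Cinfinite_bound card_nat_bound r) auto
  then show ?thesis by (rule card_subset_bound[rotated]) auto
qed

lemma card_formulas_bound:
  assumes r: "Cinfinite r" and "|funs L| \<le>o r" "|rels L| \<le>o r" "|A| \<le>o r"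
  shows "|formulas L A V| \<le>o r"
proof -
  let ?T = "{t. wf_trm L t \<and> trm_params t \<subseteq> A}"
  let ?F = "\<lambda>n. {\<theta>. wf_fm L \<theta> \<and> params \<theta> \<subseteq> A \<and> size \<theta> < n}"
  have T: "|?T| \<le>o r" by (rule card_terms_bound) (use assms in auto)
  have size: "|?F n| \<le>o r" for n
  proof (induction n)
    case 0
    show ?case using card_finite_bound[OF r finite.emptyI] by simp
  next
    case (Suc n)
    let ?S = "(\<lambda>(s, t). Eq s t) ` (?T \<times> ?T) \<union> (\<lambda>(R, ts). Rel R ts) ` (rels L \<times> {ts. set ts \<subseteq> ?T}) \<union>
      Neg ` ?F n \<union> (\<lambda>(\<theta>, \<psi>). And \<theta> \<psi>) ` (?F n \<times> ?F n) \<union> (\<lambda>(v, \<theta>). Ex v \<theta>) ` (UNIV \<times> ?F n)"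
    have "\<theta> \<in> ?S" if "\<theta> \<in> ?F (Suc n)" for \<theta>
      using that by (cases \<theta>) (force simp: image_iff)+
    then have "?F (Suc n) \<subseteq> ?S" by blast
    then show ?case
      by (rule card_subset_bound)
        (intro Un_Cinfinite_bound card_image_bound card_Times_bound card_lists_bound card_nat_bound r assms T Suc)
  qed
  have "|\<Union>n. ?F n| \<le>o r" using size by (intro UNION_Cinfinite_bound card_nat_bound r) auto
  then show ?thesis by (rule card_subset_bound[rotated]) (auto simp: formulas_def)
qed

text \<open>
  A complete theory decides every sentence, so distinct sentences of the form \<open>\<exists>v. \<theta>\<close> give distinct
  elements of the theory, either themselves or their negations. Hence the theory is at least as large as
  the language, and infinite.
\<close>

lemma card_le_theory:
  fixes T :: "('f, 'r, 'u) fm set" and h :: "'i \<Rightarrow> ('f, 'r, 'u) fm"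
  assumes T: "complete_theory L T" and h: "inj_on h I" "\<And>i. i \<in> I \<Longrightarrow> Ex 0 (h i) \<in> sentences L {}"
  shows "|I| \<le>o |T|"
proof -
  define g where "g i = (if Ex 0 (h i) \<in> T then Ex 0 (h i) else Neg (Ex 0 (h i)))" for i
  have "inj_on g I" using h(1) by (auto simp: inj_on_def g_def split: if_splits)
  moreover have "g ` I \<subseteq> T" using h(2) T by (auto simp: g_def complete_theory_def)
  ultimately show ?thesis using card_of_ordLeq by blast
qed

lemma card_funs_le_theory: "complete_theory L T \<Longrightarrow> |funs L| \<le>o |T|"
  by (rule card_le_theory[where h = "\<lambda>f. Eq (Var 0) (Fun f (replicate (fun_ar L f) (Var 0)))"])
     (auto simp: inj_on_def formulas_def)

lemma card_rels_le_theory: "complete_theory L T \<Longrightarrow> |rels L| \<le>o |T|"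
  by (rule card_le_theory[where h = "\<lambda>R. Rel R (replicate (rel_ar L R) (Var 0))"])
     (auto simp: inj_on_def formulas_def)

lemma complete_theory_infinite: "complete_theory L T \<Longrightarrow> |UNIV :: nat set| \<le>o |T|"
  by (rule card_le_theory[where h = "\<lambda>n. Ex n (Eq (Var n) (Var n))"])
     (auto simp: inj_on_def formulas_def)


section \<open>Ultrafilters and limits\<close>

text \<open>
  Zorn's lemma for the proper filters finer than \<open>F\<close>, the finer ones being the larger. The infimum
  of a nonempty chain is proper because every finite subset of the chain has a lower bound in it.
\<close>

lemma finer_ultrafilter:
  fixes F :: "'a filter"
  assumes "F \<noteq> bot"
  obtains D where "D \<le> F" "D \<noteq> bot" "\<And>P. eventually P D \<or> eventually (\<lambda>x. \<not> P x) D"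
proof -
  let ?A = "{D. D \<noteq> bot \<and> D \<le> F}" and ?P = "\<lambda>D D' :: 'a filter. D' \<le> D"
  have "partial_order_on ?A (relation_of ?P ?A)"
    by (rule partial_order_on_relation_ofI) auto
  moreover have "\<exists>u\<in>?A. \<forall>D\<in>\<C>. u \<le> D" if C: "\<C> \<in> Chains (relation_of ?P ?A)" for \<C>
  proof (cases "\<C> = {}")
    case True
    then show ?thesis using assms by auto
  next
    case False
    have sub: "D \<noteq> bot" "D \<le> F" if "D \<in> \<C>" for D
      using C that by (auto simp: Chains_def relation_of_def)
    have lin: "D \<le> D' \<or> D' \<le> D" if "D \<in> \<C>" "D' \<in> \<C>" for D D'
      using C that by (auto simp: Chains_def relation_of_def)
    have "\<exists>D\<in>\<C>. D \<le> Inf G" if "finite G" "G \<subseteq> \<C>" for G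
      using that
    proof (induction G rule: finite_induct)
      case empty
      then show ?case using False by auto
    next
      case (insert E G)
      then obtain D where D: "D \<in> \<C>" "D \<le> Inf G" by auto
      then consider "D \<le> E" | "E \<le> D" using lin[of D E] insert.prems by auto
      then show ?case
      proof cases
        case 1
        then show ?thesis using D by auto
      next
        case 2
        then show ?thesis using D insert.prems by (intro bexI[of _ E]) auto
      qed
    qed
    note lower = this
    have "Inf G \<noteq> bot" if G: "G \<subseteq> \<C>" "finite G" for G
    proof -
      obtain D where D: "D \<in> \<C>" "D \<le> Inf G" using lower[OF G(2,1)] by (rule bexE)
      then show ?thesis using sub(1)[OF D(1)] bot_unique[of D] by (metis)
    qed
    then have "Inf \<C> \<noteq> bot" by (rule Inf_filter_not_bot)
    moreover have "Inf \<C> \<le> F"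
    proof -
      obtain D where D: "D \<in> \<C>" using False by blast
      show ?thesis using D sub(2)[OF D] by (rule Inf_lower2)
    qed
    ultimately show ?thesis by (intro bexI[of _ "Inf \<C>"]) (auto intro: Inf_lower)
  qed
  ultimately obtain D where D: "D \<noteq> bot" "D \<le> F" "\<And>E. E \<noteq> bot \<Longrightarrow> E \<le> F \<Longrightarrow> E \<le> D \<Longrightarrow> E = D"
    using predicate_Zorn[of ?A ?P] by blast
  have "eventually P D \<or> eventually (\<lambda>x. \<not> P x) D" for P
  proof (rule disjCI)
    assume "\<not> eventually (\<lambda>x. \<not> P x) D"
    then have "inf D (principal {x. P x}) \<noteq> bot"
      by (simp add: trivial_limit_def eventually_inf_principal)
    then have "inf D (principal {x. P x}) = D" using D(2) by (intro D(3)) (auto intro: le_infI1)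
    moreover have "eventually P (inf D (principal {x. P x}))" by (simp add: eventually_inf_principal)
    ultimately show "eventually P D" by simp
  qed
  then show ?thesis using that D by blast
qed

lemma limitin_topology_generated_by:
  assumes l: "l \<in> \<Union>\<S>" and lim: "\<And>S. S \<in> \<S> \<Longrightarrow> l \<in> S \<Longrightarrow> \<forall>\<^sub>F i in F. f i \<in> S"
  shows "limitin (topology_generated_by \<S>) f l F"
proof -
  have "\<forall>\<^sub>F i in F. f i \<in> S" if "generate_topology_on \<S> S" "l \<in> S" for S
    using that
  proof induction
    case (Int a b)
    then show ?case by (simp add: eventually_conj)
  next
    case (UN K)
    then obtain k where "k \<in> K" "\<forall>\<^sub>F i in F. f i \<in> k" by blast
    then show ?case by (auto elim: eventually_mono)
  qed (use lim in auto)
  then show ?thesis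
    using l by (auto simp: limitin_def openin_topology_generated_by_iff)
qed


section \<open>Shattering along an ultrafilter\<close>

text \<open>
  What the argument needs to know about the monster model: \<open>X\<close> and \<open>Y\<close> are the sets of \<open>x\<close>- and
  \<open>y\<close>-tuples, \<open>R\<close> is \<open>\<phi>\<close>, and \<open>\<C>\<close> is the algebra of sets of \<open>y\<close>-tuples that are definable over \<open>M\<close>. The
  assumptions \<open>extend\<close> and \<open>realize\<close> are the two consequences of saturation that are used, one for a
  partial type in \<open>x\<close> (whose formulas quantify over \<open>y\<close>) and one for a partial type in \<open>y\<close>. In both, \<open>\<tau>\<close> is
  a pattern of truth values prescribed for \<open>R (a 0) b\<close>, \<open>R (a 1) b\<close>, \<open>\<dots>\<close>.
\<close>

locale saturated_relation =
  fixes X :: "'a set" and Y :: "'b set" and R :: "'a \<Rightarrow> 'b \<Rightarrow> bool" and \<C> :: "'b set set"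
  assumes subset: "C \<in> \<C> \<Longrightarrow> C \<subseteq> Y"
    and whole: "Y \<in> \<C>"
    and Int: "C \<in> \<C> \<Longrightarrow> C' \<in> \<C> \<Longrightarrow> C \<inter> C' \<in> \<C>"
    and compl: "C \<in> \<C> \<Longrightarrow> Y - C \<in> \<C>"
    and extend: "\<And>n a \<K>. (\<And>i. i < n \<Longrightarrow> a i \<in> X) \<Longrightarrow> \<K> \<subseteq> \<C> \<times> UNIV \<Longrightarrow>
      (\<And>K. finite K \<Longrightarrow> K \<subseteq> \<K> \<Longrightarrow>
        \<exists>x\<in>X. \<forall>(C, \<tau>)\<in>K. \<exists>b\<in>C. \<forall>i\<le>n. R ((a(n := x)) i) b = \<tau> i) \<Longrightarrow>
      \<exists>x\<in>X. \<forall>(C, \<tau>)\<in>\<K>. \<exists>b\<in>C. \<forall>i\<le>n::nat. R ((a(n := x)) i) b = \<tau> i"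
    and realize: "\<And>N a \<K> \<tau>. (\<And>i. i \<in> N \<Longrightarrow> a i \<in> X) \<Longrightarrow> \<K> \<subseteq> \<C> \<Longrightarrow>
      (\<And>K J. finite K \<Longrightarrow> K \<subseteq> \<K> \<Longrightarrow> finite J \<Longrightarrow> J \<subseteq> N \<Longrightarrow>
        \<exists>b\<in>Y. (\<forall>C\<in>K. b \<in> C) \<and> (\<forall>i\<in>J. R (a i) b = \<tau> i)) \<Longrightarrow>
      \<exists>b\<in>Y. (\<forall>C\<in>\<K>. b \<in> C) \<and> (\<forall>i\<in>N::nat set. R (a i) b = \<tau> i)"
    and no_independent_set: "\<not> (\<exists>A b. infinite A \<and> A \<subseteq> X \<and>
      (\<forall>I. I \<subseteq> A \<longrightarrow> b I \<in> Y \<and> (\<forall>a\<in>A. R a (b I) \<longleftrightarrow> a \<in> I)))"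
begin

definition same_type :: "'b \<Rightarrow> 'b \<Rightarrow> bool" where
  "same_type b b' \<longleftrightarrow> (\<forall>C\<in>\<C>. b \<in> C \<longleftrightarrow> b' \<in> C)"

text \<open>
  All patterns occur at every point of \<open>W\<close>, up to replacing the point by one of the same type over \<open>M\<close>.
  The replacement is harmless for invariant types.
\<close>

definition shatters :: "(nat \<Rightarrow> 'a) \<Rightarrow> nat \<Rightarrow> 'b set \<Rightarrow> bool" where
  "shatters a n W \<longleftrightarrow> (\<forall>i<n. a i \<in> X) \<and>
     (\<forall>y\<in>W. \<forall>\<tau>. \<exists>b\<in>Y. same_type b y \<and> (\<forall>i<n. R (a i) b = \<tau> i))"

lemma shattersD:
  "shatters a n W \<Longrightarrow> y \<in> W \<Longrightarrow> \<exists>b\<in>Y. same_type b y \<and> (\<forall>i<n. R (a i) b = \<tau> i)"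
  unfolding shatters_def by simp

lemma finite_Inter_in: "finite K \<Longrightarrow> K \<subseteq> \<C> \<Longrightarrow> Y \<inter> \<Inter>K \<in> \<C>"
proof (induction K rule: finite_induct)
  case (insert C K)
  then have "C \<inter> (Y \<inter> \<Inter>K) \<in> \<C>" using Int[of C "Y \<inter> \<Inter>K"] by simp
  moreover have "C \<inter> (Y \<inter> \<Inter>K) = Y \<inter> \<Inter>(insert C K)" by auto
  ultimately show ?case by simp
qed (simp add: whole)

text \<open>
  The patterns of one point \<open>y\<close> that lies in all \<open>W n\<close> already contradict NIP: they show that the \<open>a i\<close> are
  distinct, and by saturation every pattern on the whole sequence is realised.
\<close>

lemma shatters_infinite_False:
  assumes sh: "\<And>n. shatters a n (W n)" and y: "\<And>n. y \<in> W n"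
  shows False
proof -
  have pattern: "\<exists>b\<in>Y. \<forall>i<n. R (a i) b = \<tau> i" for n \<tau>
    using shattersD[OF sh y] by blast
  have X: "a i \<in> X" for i using sh[of "Suc i"] by (auto simp: shatters_def)
  have "a i \<noteq> a j" if "i < j" for i j
  proof -
    obtain b where "\<forall>k<Suc j. R (a k) b = (k = i)" using pattern[of "Suc j" "\<lambda>k. k = i"] by blast
    then show ?thesis using that by (metis less_Suc_eq less_irrefl)
  qed
  then have "inj a" by (metis injI linorder_neqE_nat)
  have "\<exists>b\<in>Y. (\<forall>C\<in>{}. b \<in> C) \<and> (\<forall>i\<in>UNIV. R (a i) b = (a i \<in> I))" for I
  proof (rule realize)
    fix K :: "'b set set" and J :: "nat set"
    assume "K \<subseteq> {}" "finite J"
    then obtain n where "J \<subseteq> {..<n}" using finite_nat_iff_bounded by blast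
    then show "\<exists>b\<in>Y. (\<forall>C\<in>K. b \<in> C) \<and> (\<forall>i\<in>J. R (a i) b = (a i \<in> I))"
      using pattern[of n "\<lambda>i. a i \<in> I"] \<open>K \<subseteq> {}\<close> by blast
  qed (use X in auto)
  then have "\<forall>I. \<exists>b. b \<in> Y \<and> (\<forall>i. R (a i) b = (a i \<in> I))" by auto
  then obtain b where "\<And>I. b I \<in> Y" "\<And>I i. R (a i) (b I) = (a i \<in> I)" by metis
  moreover have "infinite (range a)" using \<open>inj a\<close> by (rule range_inj_infinite)
  ultimately show False using no_independent_set X by (metis (mono_tags, lifting) imageE image_subsetI)
qed

text \<open>
  The tower \<open>W\<^sub>0 \<supseteq> W\<^sub>1 \<supseteq> \<dots>\<close>. In the step it matters that \<open>C\<close> comes before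
  ``almost every'', and that the point \<open>z\<close> of disagreement may depend on \<open>q\<close>. Restricting \<open>z\<close> to \<open>p z = \<epsilon>\<close>
  has the effect that almost every \<open>q\<close> takes the value \<open>\<epsilon>\<close> as well as the other value near \<open>y\<close>.
\<close>

primrec disputed :: "'q filter \<Rightarrow> ('q \<Rightarrow> 'b \<Rightarrow> bool) \<Rightarrow> ('b \<Rightarrow> bool) \<Rightarrow> bool \<Rightarrow> nat \<Rightarrow> 'b set" where
  "disputed D val p \<epsilon> 0 = Y"
| "disputed D val p \<epsilon> (Suc n) = {y \<in> disputed D val p \<epsilon> n. \<forall>C\<in>\<C>. y \<in> C \<longrightarrow>
     (\<forall>\<^sub>F q in D. \<exists>z\<in>C \<inter> disputed D val p \<epsilon> n. p z = \<epsilon> \<and> val q z \<noteq> \<epsilon>)}"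

declare disputed.simps(2) [simp del]

text \<open>
  For finitely many sets \<open>C\<close> meeting the next level, one type \<open>q\<close> takes both truth values on the part of the
  current level in each \<open>C\<close>. An element \<open>x\<close> that realises \<open>q\<close> on finitely many points then
  splits each of the patterns already present. Saturation yields an \<open>x\<close> that works for all \<open>C\<close>
  simultaneously, and then, for each point of the next level, points of the same type with the new patterns.
\<close>

lemma shatters_Suc:
  fixes D :: "'q filter"
  assumes D: "D \<noteq> bot" "\<forall>\<^sub>F q in D. q \<in> Z" "\<And>b. b \<in> Y \<Longrightarrow> \<forall>\<^sub>F q in D. val q b = p b"
    and inv: "\<And>q b b'. q \<in> Z \<Longrightarrow> b \<in> Y \<Longrightarrow> b' \<in> Y \<Longrightarrow> same_type b b' \<Longrightarrow> val q b = val q b'"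
    and real: "\<And>q B. q \<in> Z \<Longrightarrow> finite B \<Longrightarrow> B \<subseteq> Y \<Longrightarrow> \<exists>x\<in>X. \<forall>b\<in>B. R x b = val q b"
    and sh: "shatters a n (disputed D val p \<epsilon> n)"
  shows "\<exists>x. shatters (a(n := x)) (Suc n) (disputed D val p \<epsilon> (Suc n))"
proof -
  let ?W = "disputed D val p \<epsilon>"
  have WY: "?W m \<subseteq> Y" for m by (induction m) (auto simp: disputed.simps(2))
  have aX: "a i \<in> X" if "i < n" for i using sh that by (simp add: shatters_def)
  let ?\<K> = "{C \<in> \<C>. C \<inter> ?W (Suc n) \<noteq> {}} \<times> (UNIV :: (nat \<Rightarrow> bool) set)"
  have "\<exists>x\<in>X. \<forall>(C, \<tau>)\<in>?\<K>. \<exists>b\<in>C. \<forall>i\<le>n. R ((a(n := x)) i) b = \<tau> i"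
  proof (rule extend)
    fix K assume K: "finite K" "K \<subseteq> ?\<K>"
    \<comment> \<open>either value \<open>\<tau> n\<close> is attained: one of them at a fixed \<open>z\<close> with \<open>p z = \<epsilon>\<close>, the other where \<open>q\<close> disagrees\<close>
    have "\<forall>\<^sub>F q in D. \<exists>z\<in>C \<inter> ?W n. val q z = \<tau> n" if "(C, \<tau>) \<in> K" for C \<tau>
    proof -
      have ev: "\<forall>\<^sub>F q in D. \<exists>z\<in>C \<inter> ?W n. p z = \<epsilon> \<and> val q z \<noteq> \<epsilon>"
        using subsetD[OF K(2) that] by (auto simp: disputed.simps(2))
      then obtain z where z: "z \<in> C \<inter> ?W n" "p z = \<epsilon>"
        using eventually_happens'[OF D(1) ev] by blast
      then have "\<forall>\<^sub>F q in D. val q z = \<epsilon>" using D(3)[of z] WY by auto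
      with ev show ?thesis
        by eventually_elim (use z in blast)
    qed
    then have "\<forall>\<^sub>F q in D. \<forall>c\<in>K. \<exists>z\<in>fst c \<inter> ?W n. val q z = snd c n"
      using K(1) by (intro eventually_ball_finite) auto
    from eventually_happens'[OF D(1) eventually_conj[OF D(2) this]]
    obtain q where q: "q \<in> Z" "\<forall>c\<in>K. \<exists>z\<in>fst c \<inter> ?W n. val q z = snd c n" by blast
    \<comment> \<open>a point \<open>b\<close> of the type of \<open>z\<close> which has the required pattern; by invariance \<open>q\<close> has the same value at \<open>b\<close> and \<open>z\<close>\<close>
    have "\<exists>b\<in>fst c. val q b = snd c n \<and> (\<forall>i<n. R (a i) b = snd c i)" if c: "c \<in> K" for c
    proof -
      obtain z where z: "z \<in> fst c" "z \<in> ?W n" "val q z = snd c n" using q(2) c by blast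
      from shattersD[OF sh z(2), of "snd c"]
      obtain b where b: "b \<in> Y" "same_type b z" "\<forall>i<n. R (a i) b = snd c i" by blast
      have "fst c \<in> \<C>" using subsetD[OF K(2) c] by auto
      then have "b \<in> fst c" using z b(2) unfolding same_type_def by blast
      moreover have "val q b = val q z" using inv[OF q(1) b(1) _ b(2)] subsetD[OF WY z(2)] .
      ultimately show ?thesis using b z by auto
    qed
    then obtain b where b: "\<And>c. c \<in> K \<Longrightarrow> b c \<in> fst c \<and> val q (b c) = snd c n \<and> (\<forall>i<n. R (a i) (b c) = snd c i)"
      by metis
    have "b ` K \<subseteq> Y" using b K(2) subset by fastforce
    then obtain x where x: "x \<in> X" "\<forall>c\<in>K. R x (b c) = val q (b c)" using real[OF q(1), of "b ` K"] K(1) by auto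
    have "R ((a(n := x)) i) (b c) = snd c i" if "c \<in> K" "i \<le> n" for c i
      using b[OF that(1)] x that by (cases "i = n") auto
    then show "\<exists>x\<in>X. \<forall>(C, \<tau>)\<in>K. \<exists>b\<in>C. \<forall>i\<le>n. R ((a(n := x)) i) b = \<tau> i"
      using b x(1) by (intro bexI[of _ x]) fastforce+
  qed (use aX in auto)
  then obtain x where x: "x \<in> X"
    "\<forall>(C, \<tau>)\<in>?\<K>. \<exists>b\<in>C. \<forall>i\<le>n. R ((a(n := x)) i) b = \<tau> i"
    by (rule bexE)
  have near: "\<exists>b\<in>C. \<forall>i\<le>n. R ((a(n := x)) i) b = \<tau> i"
    if "C \<in> \<C>" "y \<in> C" "y \<in> ?W (Suc n)" for C y \<tau>
    using bspec[OF x(2), of "(C, \<tau>)"] that by blast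
  have X: "(a(n := x)) i \<in> X" if "i \<le> n" for i using aX x(1) that by auto
  have "\<exists>b\<in>Y. same_type b y \<and> (\<forall>i<Suc n. R ((a(n := x)) i) b = \<tau> i)" if y: "y \<in> ?W (Suc n)" for y \<tau>
  proof -
    have "\<exists>b\<in>Y. (\<forall>C\<in>{C\<in>\<C>. y \<in> C}. b \<in> C) \<and> (\<forall>i\<in>{..n}. R ((a(n := x)) i) b = \<tau> i)"
    proof (rule realize)
      fix K J assume K: "finite K" "K \<subseteq> {C \<in> \<C>. y \<in> C}" and J: "J \<subseteq> {..n}"
      have "Y \<inter> \<Inter>K \<in> \<C>" using K by (intro finite_Inter_in) auto
      moreover have "y \<in> Y \<inter> \<Inter>K" using subsetD[OF WY y] K by blast
      ultimately obtain b where "b \<in> Y \<inter> \<Inter>K" "\<forall>i\<le>n. R ((a(n := x)) i) b = \<tau> i"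
        using near[OF _ _ y] by (metis (no_types, lifting))
      then show "\<exists>b\<in>Y. (\<forall>C\<in>K. b \<in> C) \<and> (\<forall>i\<in>J. R ((a(n := x)) i) b = \<tau> i)" using J by blast
    qed (use X in auto)
    then obtain b where b: "b \<in> Y" "\<And>C. C \<in> \<C> \<Longrightarrow> y \<in> C \<Longrightarrow> b \<in> C" "\<forall>i\<le>n. R ((a(n := x)) i) b = \<tau> i"
      by auto
    \<comment> \<open>a set that contains \<open>b\<close> also contains \<open>y\<close>, since otherwise its complement is one of the sets realised by \<open>b\<close>\<close>
    have "y \<in> C" if "C \<in> \<C>" "b \<in> C" for C
      using b(2)[OF compl[OF that(1)]] that(2) subsetD[OF WY y] by blast
    then have "same_type b y" using b(2) by (auto simp: same_type_def)
    then show ?thesis using b(1,3) unfolding less_Suc_eq_le by blast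
  qed
  then have "shatters (a(n := x)) (Suc n) (?W (Suc n))" using X by (auto simp: shatters_def less_Suc_eq_le)
  then show ?thesis by blast
qed

text \<open>
  Otherwise every level is nonempty, and the shattering elements can be chosen one after the other, the
  first \<open>n\<close> of them staying the same from level \<open>n\<close> on.
\<close>

lemma disputed_exhausted:
  fixes D :: "'q filter"
  assumes D: "D \<noteq> bot" "\<forall>\<^sub>F q in D. q \<in> Z" "\<And>b. b \<in> Y \<Longrightarrow> \<forall>\<^sub>F q in D. val q b = p b"
    and inv: "\<And>q b b'. q \<in> Z \<Longrightarrow> b \<in> Y \<Longrightarrow> b' \<in> Y \<Longrightarrow> same_type b b' \<Longrightarrow> val q b = val q b'"
    and real: "\<And>q B. q \<in> Z \<Longrightarrow> finite B \<Longrightarrow> B \<subseteq> Y \<Longrightarrow> \<exists>x\<in>X. \<forall>b\<in>B. R x b = val q b"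
  shows "\<exists>n. y \<notin> disputed D val p \<epsilon> n"
proof (rule ccontr)
  let ?W = "disputed D val p \<epsilon>"
  assume "\<not> ?thesis"
  then have y: "y \<in> ?W n" for n by blast
  have "\<exists>f. \<forall>n. shatters (f n) n (?W n) \<and> (\<exists>x. f (Suc n) = (f n)(n := x))"
  proof (rule dependent_nat_choice)
    show "\<exists>a. shatters a 0 (?W 0)" by (auto simp: shatters_def same_type_def)
    fix a n assume "shatters a n (?W n)"
    from shatters_Suc[OF D inv real this]
    show "\<exists>b. shatters b (Suc n) (?W (Suc n)) \<and> (\<exists>x. b = a(n := x))" by blast
  qed
  then obtain f where f: "\<And>n. shatters (f n) n (?W n)" "\<And>n. \<exists>x. f (Suc n) = (f n)(n := x)" by blast
  have stable: "f n i = f (Suc i) i" if "i < n" for i n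
    using that
  proof (induction n)
    case (Suc n)
    then show ?case using f(2)[of n] by (cases "i = n") auto
  qed simp
  have "shatters (\<lambda>i. f (Suc i) i) n (?W n)" for n
    using f(1)[of n] stable[of _ n] by (simp add: shatters_def)
  then show False using shatters_infinite_False y by blast
qed

text \<open>
  A pointwise limit along an ultrafilter is turned into one along the finite subsets of \<open>\<kappa>\<close>. It is not
  enough to let \<open>r i\<close> agree with \<open>p\<close> on finite sets of points, as \<open>Y\<close> may be larger than \<open>\<kappa>\<close>;
  instead \<open>r i\<close> has to satisfy finitely many conditions that hold for almost every \<open>q\<close>, out of a list
  of only \<open>\<kappa>\<close> conditions.
\<close>

theorem approximating_family:
  fixes \<kappa> :: "'k rel" and Z :: "'q set"
  assumes \<kappa>: "Cinfinite \<kappa>" "|\<C>| \<le>o \<kappa>"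
    and inv: "\<And>q b b'. q \<in> Z \<Longrightarrow> b \<in> Y \<Longrightarrow> b' \<in> Y \<Longrightarrow> same_type b b' \<Longrightarrow> val q b = val q b'"
    and real: "\<And>q B. q \<in> Z \<Longrightarrow> finite B \<Longrightarrow> B \<subseteq> Y \<Longrightarrow> \<exists>x\<in>X. \<forall>b\<in>B. R x b = val q b"
    and dense: "\<And>B. finite B \<Longrightarrow> B \<subseteq> Y \<Longrightarrow> \<exists>q\<in>Z. \<forall>b\<in>B. val q b = p b"
  shows "\<exists>r :: 'k set \<Rightarrow> 'q. (\<forall>i\<in>Fpow (Field \<kappa>). r i \<in> Z) \<and>
    (\<forall>b\<in>Y. \<forall>\<^sub>F i in fin_filter \<kappa>. val (r i) b = p b)"
proof -
  let ?F = "INF B\<in>{B. finite B \<and> B \<subseteq> Y}. principal {q \<in> Z. \<forall>b\<in>B. val q b = p b}"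
  have ev_F: "eventually P ?F \<longleftrightarrow> (\<exists>B. (finite B \<and> B \<subseteq> Y) \<and> (\<forall>q\<in>Z. (\<forall>b\<in>B. val q b = p b) \<longrightarrow> P q))" for P
  proof (subst eventually_INF_base)
    fix B B' assume "B \<in> {B. finite B \<and> B \<subseteq> Y}" "B' \<in> {B. finite B \<and> B \<subseteq> Y}"
    then show "\<exists>x\<in>{B. finite B \<and> B \<subseteq> Y}. principal {q \<in> Z. \<forall>b\<in>x. val q b = p b}
        \<le> inf (principal {q \<in> Z. \<forall>b\<in>B. val q b = p b}) (principal {q \<in> Z. \<forall>b\<in>B'. val q b = p b})"
      by (intro bexI[of _ "B \<union> B'"]) auto
  qed (auto simp: eventually_principal)
  have F: "?F \<noteq> bot" unfolding trivial_limit_def ev_F using dense by blast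
  obtain D where D: "D \<le> ?F" "D \<noteq> bot" "\<And>P. eventually P D \<or> eventually (\<lambda>q. \<not> P q) D"
    by (rule finer_ultrafilter[OF F]) (rule that)
  have DZ: "\<forall>\<^sub>F q in D. q \<in> Z"
    by (rule filter_leD[OF D(1)]) (auto simp: ev_F)
  have Dp: "\<forall>\<^sub>F q in D. val q b = p b" if "b \<in> Y" for b
    by (rule filter_leD[OF D(1)]) (use that in \<open>auto simp: ev_F intro!: exI[of _ "{b}"]\<close>)
  let ?W = "disputed D val p"
  define good where "good c q \<longleftrightarrow> (case c of (C, n, \<epsilon>) \<Rightarrow> \<forall>z\<in>C \<inter> ?W \<epsilon> n. p z = \<epsilon> \<longrightarrow> val q z = \<epsilon>)" for c q
  let ?J = "\<C> \<times> (UNIV :: nat set) \<times> (UNIV :: bool set)"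
  have "|?J| \<le>o \<kappa>"
    by (intro card_Times_bound card_nat_bound card_finite_bound[where A = "UNIV :: bool set"] \<kappa>) simp
  moreover have "\<kappa> =o |Field \<kappa>|" using \<kappa>(1) card_of_Field_ordIso ordIso_symmetric by blast
  ultimately have "|?J| \<le>o |Field \<kappa>|" using ordLeq_ordIso_trans by blast
  then obtain g where g: "inj_on g ?J" "g ` ?J \<subseteq> Field \<kappa>" using card_of_ordLeq[of ?J "Field \<kappa>"] by auto
  have "\<exists>q\<in>Z. \<forall>c\<in>?J. g c \<in> i \<and> eventually (good c) D \<longrightarrow> good c q" if "i \<in> Fpow (Field \<kappa>)" for i
  proof -
    have "finite i" using that by (simp add: Fpow_def)
    then have "finite {c \<in> ?J. g c \<in> i \<and> eventually (good c) D}"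
      using g(1) by (rule_tac finite_subset[OF _ finite_vimage_IntI[of i g ?J]]) auto
    then have "\<forall>\<^sub>F q in D. \<forall>c\<in>{c \<in> ?J. g c \<in> i \<and> eventually (good c) D}. good c q"
      by (rule eventually_ball_finite) auto
    from eventually_happens'[OF D(2) eventually_conj[OF DZ this]] show ?thesis by blast
  qed
  then obtain r where r: "\<And>i. i \<in> Fpow (Field \<kappa>) \<Longrightarrow> r i \<in> Z"
    "\<And>i c. i \<in> Fpow (Field \<kappa>) \<Longrightarrow> c \<in> ?J \<Longrightarrow> g c \<in> i \<Longrightarrow> eventually (good c) D \<Longrightarrow> good c (r i)"
    by metis
  have "\<forall>\<^sub>F i in fin_filter \<kappa>. val (r i) b = p b" if b: "b \<in> Y" for b
  proof -
    obtain m where "b \<notin> ?W (p b) m" using disputed_exhausted[OF D(2) DZ Dp inv real] by blast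
    moreover have "b \<in> ?W (p b) 0" using b by simp
    ultimately obtain n where n: "b \<in> ?W (p b) n" "b \<notin> ?W (p b) (Suc n)"
      using zero_induct[of "\<lambda>k. b \<notin> ?W (p b) k" m] by metis
    then obtain C where C: "C \<in> \<C>" "b \<in> C"
      "\<not> (\<forall>\<^sub>F q in D. \<exists>z\<in>C \<inter> ?W (p b) n. p z = p b \<and> val q z \<noteq> p b)"
      by (auto simp: disputed.simps(2))
    let ?c = "(C, n, p b)"
    \<comment> \<open>failure of ``almost every \<open>q\<close> disagrees'' means ``almost no \<open>q\<close> disagrees'', as \<open>D\<close> is an ultrafilter\<close>
    have "\<forall>\<^sub>F q in D. \<not> (\<exists>z\<in>C \<inter> ?W (p b) n. p z = p b \<and> val q z \<noteq> p b)"
      using C(3) D(3)[of "\<lambda>q. \<exists>z\<in>C \<inter> ?W (p b) n. p z = p b \<and> val q z \<noteq> p b"] by blast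
    then have "eventually (good ?c) D"
      by eventually_elim (auto simp: good_def)
    then have "good ?c (r i)" if "finite i" "i \<subseteq> Field \<kappa>" "g ?c \<in> i" for i
      using r(2)[of i ?c] C(1) that by (auto simp: Fpow_def)
    then have "val (r i) b = p b" if "finite i" "i \<subseteq> Field \<kappa>" "g ?c \<in> i" for i
      using C(2) n(1) that by (auto simp: good_def)
    moreover have "g ?c \<in> Field \<kappa>" using g(2) C(1) by auto
    ultimately show ?thesis
      unfolding eventually_finite_subsets_at_top by (intro exI[of _ "{g ?c}"]) auto
  qed
  then show ?thesis using r(1) by (intro exI[of _ r]) auto
qed

end


section \<open>The monster model\<close>

abbreviation relates ::
    "('f, 'r, 'u) struct \<Rightarrow> ('f, 'r, 'u) fm \<Rightarrow> nat list \<Rightarrow> nat list \<Rightarrow> 'u list \<Rightarrow> 'u list \<Rightarrow> bool" where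
  "relates U \<phi> xs ys a b \<equiv> holds U (inst xs a (inst ys b \<phi>))"

lemma fv_inst: "length b = length ys \<Longrightarrow> fv (inst ys b \<phi>) = fv \<phi> - set ys"
  by (simp add: inst_def fv_subst dom_map_of_zip)

lemma relates_map:
  assumes "partitioned_formula L \<phi> xs ys" "range e \<subseteq> univ U"
  shows "relates U \<phi> xs ys (map e xs) (map e ys) \<longleftrightarrow> sat U e \<phi>"
proof -
  have "fv (inst ys (map e ys) \<phi>) \<subseteq> set xs"
    using assms(1) by (auto simp: fv_inst partitioned_formula_def formulas_def)
  then have "relates U \<phi> xs ys (map e xs) (map e ys) \<longleftrightarrow> sat U e (inst ys (map e ys) \<phi>)"
    by (rule holds_inst_iff[OF _ assms(2)])
  moreover have "override (map_of (zip ys (map e ys))) e = e"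
    by (auto simp: override_def map_of_zip_map)
  ultimately show ?thesis by (simp add: inst_def sat_subst)
qed

lemma definable_relates:
  assumes "partitioned_formula L \<phi> xs ys"
  shows "definable L U A (set xs \<union> set ys) (\<lambda>e. relates U \<phi> xs ys (map e xs) (map e ys))"
  by (rule definableI[of \<phi>])
    (use assms relates_map[OF assms] in \<open>auto simp: partitioned_formula_def formulas_def\<close>)

lemma definable_relates_fixed:
  assumes pf: "partitioned_formula L \<phi> xs ys" and a: "a \<in> tuples (univ U) (length xs)" and A: "set a \<subseteq> A"
  shows "definable L U A (set ys) (\<lambda>e. relates U \<phi> xs ys a (map e ys))"
proof -
  let ?s = "map_of (zip xs a)"
  have len: "length a = length xs" and sub: "set a \<subseteq> univ U" using a by (auto simp: tuples_def)
  have ran: "ran ?s \<subseteq> set a" by (auto simp: ran_def dest!: map_of_SomeD set_zip_rightD)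
  have xs: "distinct xs" and disj: "set xs \<inter> set ys = {}"
    using pf by (auto simp: partitioned_formula_def)
  have "definable L U ({} \<union> ran ?s) (set xs \<union> set ys - dom ?s)
      (\<lambda>e. relates U \<phi> xs ys (map (override ?s e) xs) (map (override ?s e) ys))"
    by (rule definable_subst[OF definable_relates[OF pf]]) (use ran sub in blast)
  moreover have "map (override ?s e) xs = a" for e
    using len xs by (auto intro!: nth_equalityI simp: override_def map_of_zip_nth)
  moreover have "map (override ?s e) ys = map e ys" for e
    using disj len by (auto simp: override_def split: option.split dest!: map_of_SomeD set_zip_leftD)
  ultimately show ?thesis using ran A len disj by (auto elim!: definable_mono simp: dom_map_of_zip)
qed

definition definable_sets ::
    "('f, 'r) lang \<Rightarrow> ('f, 'r, 'u) struct \<Rightarrow> 'u set \<Rightarrow> nat list \<Rightarrow> 'u list set set" where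
  "definable_sets L U A ys =
     (\<lambda>\<theta>. {b \<in> tuples (univ U) (length ys). holds U (inst ys b \<theta>)}) ` formulas L A (set ys)"

lemma map_in_tuples: "range e \<subseteq> A \<Longrightarrow> map e vs \<in> tuples A (length vs)"
  by (auto simp: tuples_def)

lemma definable_in_definable_set:
  assumes "C \<in> definable_sets L U A ys"
  shows "definable L U A (set ys) (\<lambda>e. map e ys \<in> C)"
proof -
  obtain \<theta> where \<theta>: "\<theta> \<in> formulas L A (set ys)"
    "C = {b \<in> tuples (univ U) (length ys). holds U (inst ys b \<theta>)}"
    using assms by (auto simp: definable_sets_def)
  show ?thesis
    by (rule definableI[OF \<theta>(1)])
      (use \<theta> holds_inst_iff[of \<theta> ys _ U] in \<open>auto simp: map_in_tuples formulas_def\<close>)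
qed

text \<open>
  The description through definable predicates makes the closure of these sets under Boolean operations evident.
\<close>

lemma definable_sets_iff:
  assumes "distinct ys" "univ U \<noteq> {}"
  shows "C \<in> definable_sets L U A ys \<longleftrightarrow>
    C \<subseteq> tuples (univ U) (length ys) \<and> definable L U A (set ys) (\<lambda>e. map e ys \<in> C)"
proof
  assume "C \<in> definable_sets L U A ys"
  then show "C \<subseteq> tuples (univ U) (length ys) \<and> definable L U A (set ys) (\<lambda>e. map e ys \<in> C)"
    by (intro conjI definable_in_definable_set) (auto simp: definable_sets_def)
next
  assume C: "C \<subseteq> tuples (univ U) (length ys) \<and> definable L U A (set ys) (\<lambda>e. map e ys \<in> C)"
  then obtain \<theta> where \<theta>: "\<theta> \<in> formulas L A (set ys)"
    "\<And>e. range e \<subseteq> univ U \<Longrightarrow> sat U e \<theta> \<longleftrightarrow> map e ys \<in> C"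
    unfolding definable_def by blast
  have "b \<in> C \<longleftrightarrow> holds U (inst ys b \<theta>)" if b: "b \<in> tuples (univ U) (length ys)" for b
  proof -
    obtain e where e: "range e \<subseteq> univ U" "map e ys = b" using tuple_as_map[OF b assms] by blast
    then show ?thesis using \<theta> holds_inst_iff[of \<theta> ys e U] by (auto simp: formulas_def)
  qed
  then have "C = {b \<in> tuples (univ U) (length ys). holds U (inst ys b \<theta>)}" using C by blast
  then show "C \<in> definable_sets L U A ys" using \<theta>(1) by (auto simp: definable_sets_def)
qed

lemma tuple_parameters_small:
  fixes N :: "nat set"
  assumes "Cinfinite \<mu>" "natLeq <o \<mu>" "|A| <o \<mu>"
  shows "|A \<union> (\<Union>i\<in>N. set (a i))| <o \<mu>"
proof -
  have "|\<Union>i\<in>N. set (a i)| \<le>o natLeq"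
    by (intro UNION_Cinfinite_bound card_nat_bound natLeq_Cinfinite ballI card_finite_bound) simp
  then show ?thesis
    using assms by (intro Un_Cinfinite_bound_strict) (auto intro: ordLeq_ordLess_trans)
qed

text \<open>
  Both saturation properties are about partial types over \<open>A\<close> together with countably many further
  parameters. This set is small, since \<open>\<mu>\<close> is uncountable.
\<close>

proposition saturated_relation_monster:
  assumes sat: "saturated L \<mu> U" and ne: "univ U \<noteq> {}" and \<mu>: "Cinfinite \<mu>" "natLeq <o \<mu>"
    and A: "A \<subseteq> univ U" "|A| <o \<mu>"
    and pf: "partitioned_formula L \<phi> xs ys" and nip: "NIP U \<phi> xs ys"
  shows "saturated_relation (tuples (univ U) (length xs)) (tuples (univ U) (length ys))
    (relates U \<phi> xs ys) (definable_sets L U A ys)"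
proof
  let ?X = "tuples (univ U) (length xs)" and ?Y = "tuples (univ U) (length ys)"
  let ?R = "relates U \<phi> xs ys" and ?\<C> = "definable_sets L U A ys"
  have dist: "distinct xs" "distinct ys" and disj: "set xs \<inter> set ys = {}"
    using pf by (auto simp: partitioned_formula_def)
  note iff = definable_sets_iff[OF dist(2) ne]
  have mapY: "map e ys \<in> ?Y" if "range e \<subseteq> univ U" for e using that by (rule map_in_tuples)
  show "C \<subseteq> ?Y" if "C \<in> ?\<C>" for C using that by (simp add: iff)
  show "?Y \<in> ?\<C>"
    unfolding iff
    by (intro conjI order_refl definable_equiv[OF definable_True]) (simp add: mapY)
  show "C \<inter> C' \<in> ?\<C>" if "C \<in> ?\<C>" "C' \<in> ?\<C>" for C C'
    using that definable_and[of L U A "set ys" "\<lambda>e. map e ys \<in> C" "\<lambda>e. map e ys \<in> C'"]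
    by (auto simp: iff)
  show "?Y - C \<in> ?\<C>" if "C \<in> ?\<C>" for C
  proof -
    have "definable L U A (set ys) (\<lambda>e. map e ys \<notin> C)"
      using that by (intro definable_not definable_in_definable_set)
    then have "definable L U A (set ys) (\<lambda>e. map e ys \<in> ?Y - C)"
      by (rule definable_equiv) (use mapY in auto)
    then show ?thesis by (simp add: iff)
  qed
  show "\<exists>x\<in>?X. \<forall>(C, \<tau>)\<in>\<K>. \<exists>b\<in>C. \<forall>i\<le>n. ?R ((a(n := x)) i) b = \<tau> i"
    if a: "\<And>i. i < n \<Longrightarrow> a i \<in> ?X" and \<K>: "\<K> \<subseteq> ?\<C> \<times> UNIV"
      and fin: "\<And>K. finite K \<Longrightarrow> K \<subseteq> \<K> \<Longrightarrow>
        \<exists>x\<in>?X. \<forall>(C, \<tau>)\<in>K. \<exists>b\<in>C. \<forall>i\<le>n. ?R ((a(n := x)) i) b = \<tau> i"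
    for n :: nat and a \<K>
  proof -
    let ?A = "A \<union> (\<Union>i\<in>{..<n}. set (a i))"
    let ?P = "\<lambda>c e. \<exists>b\<in>fst c. \<forall>i\<le>n. ?R ((a(n := map e xs)) i) b = snd c i"
    have "\<exists>e. range e \<subseteq> univ U \<and> (\<forall>c\<in>\<K>. ?P c e)"
    proof (rule saturated_family[OF sat ne \<mu>(1), where V = "set xs" and A = ?A])
      show "?A \<subseteq> univ U" using A a by (auto simp: tuples_def)
      show "|?A| <o \<mu>" by (rule tuple_parameters_small[OF \<mu> A(2)])
    next
      fix c assume "c \<in> \<K>"
      then have C: "fst c \<in> ?\<C>" using \<K> by auto
      \<comment> \<open>\<open>?P c\<close> arises from \<open>?Q\<close> by quantifying over the variables \<open>ys\<close>, whose values form the tuple \<open>b\<close>\<close>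
      let ?Q = "\<lambda>e. map e ys \<in> fst c \<and> (\<forall>i\<in>{..<n}. ?R (a i) (map e ys) = snd c i) \<and>
        ?R (map e xs) (map e ys) = snd c n"
      have "definable L U ?A (set xs \<union> set ys) ?Q"
      proof (intro definable_and definable_ball definable_iff_const)
        show "definable L U ?A (set xs \<union> set ys) (\<lambda>e. map e ys \<in> fst c)"
          by (rule definable_mono[OF definable_in_definable_set[OF C]]) auto
        fix i assume i: "i \<in> {..<n}"
        show "definable L U ?A (set xs \<union> set ys) (\<lambda>e. ?R (a i) (map e ys))"
          by (rule definable_mono[OF definable_relates_fixed[OF pf a order_refl]]) (use i in auto)
      next
        show "definable L U ?A (set xs \<union> set ys) (\<lambda>e. ?R (map e xs) (map e ys))"
          by (rule definable_relates[OF pf])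
      qed simp
      from definable_ex[OF finite_set[of ys] this]
      have "definable L U ?A (set xs \<union> set ys - set ys) (?P c)"
      proof (rule definable_equiv)
        fix e :: "nat \<Rightarrow> 'd" assume e: "range e \<subseteq> univ U"
        show "(\<exists>e'. range e' \<subseteq> univ U \<and> (\<forall>v. v \<notin> set ys \<longrightarrow> e' v = e v) \<and> ?Q e') \<longleftrightarrow> ?P c e"
        proof
          assume "\<exists>e'. range e' \<subseteq> univ U \<and> (\<forall>v. v \<notin> set ys \<longrightarrow> e' v = e v) \<and> ?Q e'"
          then obtain e' where e': "\<forall>v. v \<notin> set ys \<longrightarrow> e' v = e v" "?Q e'" by blast
          have "map e' xs = map e xs" using e'(1) disj by auto
          then have "?R (map e xs) (map e' ys) = snd c n" using e'(2) by metis
          then have "?R ((a(n := map e xs)) i) (map e' ys) = snd c i" if "i \<le> n" for i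
            using e'(2) that by (cases "i = n") auto
          then show "?P c e" using e'(2) by blast
        next
          assume "?P c e"
          then obtain b where b: "b \<in> fst c" "\<forall>i\<le>n. ?R ((a(n := map e xs)) i) b = snd c i" by blast
          have "b \<in> ?Y" using b(1) C by (auto simp: iff)
          then obtain e1 where e1: "range e1 \<subseteq> univ U" "map e1 ys = b" using tuple_as_map dist(2) ne by metis
          define e' where "e' v = (if v \<in> set ys then e1 v else e v)" for v
          have maps: "map e' ys = b" "map e' xs = map e xs" using e1(2) disj by (auto simp: e'_def)
          have "?R (a i) b = snd c i" if "i < n" for i using b(2)[rule_format, of i] that by auto
          moreover have "?R (map e xs) b = snd c n" using b(2)[rule_format, of n] by auto
          ultimately have "?Q e'" unfolding maps using b(1) by simp
          moreover have "range e' \<subseteq> univ U" using e e1(1) by (auto simp: e'_def)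
          ultimately show "\<exists>e'. range e' \<subseteq> univ U \<and> (\<forall>v. v \<notin> set ys \<longrightarrow> e' v = e v) \<and> ?Q e'"
            by (intro exI[of _ e']) (simp add: e'_def)
        qed
      qed
      moreover have "set xs \<union> set ys - set ys = set xs" using disj by blast
      ultimately show "definable L U ?A (set xs) (?P c)" by simp
    next
      fix K assume K: "K \<subseteq> \<K>" "finite K"
      obtain x where x: "x \<in> ?X" "\<forall>(C, \<tau>)\<in>K. \<exists>b\<in>C. \<forall>i\<le>n. ?R ((a(n := x)) i) b = \<tau> i"
        using fin[OF K(2,1)] by (rule bexE)
      obtain e where "range e \<subseteq> univ U" "map e xs = x" using tuple_as_map[OF x(1) dist(1) ne] .
      then show "\<exists>e. range e \<subseteq> univ U \<and> (\<forall>c\<in>K. ?P c e)"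
        using x(2) by (intro exI[of _ e]) (simp add: case_prod_unfold)
    qed simp
    then obtain e where e: "range e \<subseteq> univ U" "\<forall>c\<in>\<K>. ?P c e" by (elim exE conjE)
    show ?thesis
      by (rule bexI[of _ "map e xs"]) (use e map_in_tuples[OF e(1)] in \<open>auto simp: case_prod_unfold\<close>)
  qed
  show "\<exists>b\<in>?Y. (\<forall>C\<in>\<K>. b \<in> C) \<and> (\<forall>i\<in>N. ?R (a i) b = \<tau> i)"
    if a: "\<And>i. i \<in> N \<Longrightarrow> a i \<in> ?X" and \<K>: "\<K> \<subseteq> ?\<C>"
      and fin: "\<And>K J. finite K \<Longrightarrow> K \<subseteq> \<K> \<Longrightarrow> finite J \<Longrightarrow> J \<subseteq> N \<Longrightarrow>
        \<exists>b\<in>?Y. (\<forall>C\<in>K. b \<in> C) \<and> (\<forall>i\<in>J. ?R (a i) b = \<tau> i)"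
    for N :: "nat set" and a \<K> \<tau>
  proof -
    let ?A = "A \<union> (\<Union>i\<in>N. set (a i))"
    \<comment> \<open>the type consists of formulas of two kinds: membership in \<open>C\<close>, and the prescribed value of \<open>R (a i)\<close>\<close>
    let ?P = "case_sum (\<lambda>C e. map e ys \<in> C) (\<lambda>i e. ?R (a i) (map e ys) = \<tau> i)"
    have "\<exists>e. range e \<subseteq> univ U \<and> (\<forall>c\<in>\<K> <+> N. ?P c e)"
    proof (rule saturated_family[OF sat ne \<mu>(1), where V = "set ys" and A = ?A])
      show "?A \<subseteq> univ U" using A a by (auto simp: tuples_def)
      show "|?A| <o \<mu>" by (rule tuple_parameters_small[OF \<mu> A(2)])
    next
      fix c assume c: "c \<in> \<K> <+> N"
      show "definable L U ?A (set ys) (?P c)"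
      proof (cases c)
        case (Inl C)
        then have "C \<in> ?\<C>" using c \<K> by auto
        then have "definable L U ?A (set ys) (\<lambda>e. map e ys \<in> C)"
          by (rule definable_mono[OF definable_in_definable_set]) auto
        then show ?thesis by (simp add: Inl)
      next
        case (Inr i)
        then have i: "i \<in> N" using c by auto
        have "definable L U ?A (set ys) (\<lambda>e. ?R (a i) (map e ys) = \<tau> i)"
          by (intro definable_iff_const definable_relates_fixed[OF pf a[OF i]]) (use i in auto)
        then show ?thesis by (simp add: Inr)
      qed
    next
      fix F assume F: "F \<subseteq> \<K> <+> N" "finite F"
      have "finite (Inl -` F)" "finite (Inr -` F)" "Inl -` F \<subseteq> \<K>" "Inr -` F \<subseteq> N"
        using F by (auto intro!: finite_vimageI)
      then obtain b where b: "b \<in> ?Y" "\<forall>C\<in>Inl -` F. b \<in> C" "\<forall>i\<in>Inr -` F. ?R (a i) b = \<tau> i"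
        using fin[of "Inl -` F" "Inr -` F"] by blast
      obtain e where e: "range e \<subseteq> univ U" "map e ys = b" using tuple_as_map[OF b(1) dist(2) ne] .
      have "?P c e" if "c \<in> F" for c using b(2,3) that by (cases c) (auto simp: e(2))
      then show "\<exists>e. range e \<subseteq> univ U \<and> (\<forall>c\<in>F. ?P c e)" using e(1) by blast
    qed simp
    then obtain e where e: "range e \<subseteq> univ U" "\<forall>c\<in>\<K> <+> N. ?P c e" by (elim exE conjE)
    have "map e ys \<in> C" if "C \<in> \<K>" for C using bspec[OF e(2) InlI[OF that]] by simp
    moreover have "?R (a i) (map e ys) = \<tau> i" if "i \<in> N" for i
      using bspec[OF e(2) InrI[OF that]] by simp
    ultimately show ?thesis using mapY[OF e(1)] by (intro bexI[of _ "map e ys"]) simp_all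
  qed
  show "\<not> (\<exists>A b. infinite A \<and> A \<subseteq> ?X \<and> (\<forall>I. I \<subseteq> A \<longrightarrow> b I \<in> ?Y \<and> (\<forall>a\<in>A. ?R a (b I) \<longleftrightarrow> a \<in> I)))"
    using nip unfolding NIP_def .
qed


section \<open>Spaces of types\<close>

lemma holds_inst_Neg:
  assumes "fv \<psi> \<subseteq> set xs" "distinct xs" "univ U \<noteq> {}" "a \<in> tuples (univ U) (length xs)"
  shows "holds U (inst xs a (Neg \<psi>)) \<longleftrightarrow> \<not> holds U (inst xs a \<psi>)"
proof -
  obtain e where "range e \<subseteq> univ U" "map e xs = a" using tuple_as_map[OF assms(4,2,3)] .
  then show ?thesis using assms(1) holds_inst_iff[of \<psi> xs e U] holds_inst_iff[of "Neg \<psi>" xs e U] by auto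
qed

lemma consistentD:
  "consistent U xs q \<Longrightarrow> F \<subseteq> q \<Longrightarrow> finite F \<Longrightarrow>
    \<exists>a\<in>tuples (univ U) (length xs). \<forall>\<theta>\<in>F. holds U (inst xs a \<theta>)"
  unfolding consistent_def by simp

lemma inconsistentE:
  assumes "\<not> consistent U xs q"
  obtains F where "F \<subseteq> q" "finite F"
    "\<And>a. a \<in> tuples (univ U) (length xs) \<Longrightarrow> \<exists>\<theta>\<in>F. \<not> holds U (inst xs a \<theta>)"
proof -
  have "\<exists>F. F \<subseteq> q \<and> finite F \<and>
      \<not> (\<exists>a\<in>tuples (univ U) (length xs). \<forall>\<theta>\<in>F. holds U (inst xs a \<theta>))"
    using assms unfolding consistent_def by simp
  then obtain F where F: "F \<subseteq> q" "finite F"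
    "\<not> (\<exists>a\<in>tuples (univ U) (length xs). \<forall>\<theta>\<in>F. holds U (inst xs a \<theta>))" by (elim exE conjE)
  show ?thesis by (rule that[OF F(1,2)]) (use F(3) in simp)
qed

context
  fixes L :: "('f, 'r) lang" and U :: "('f, 'r, 'u) struct" and \<phi> :: "('f, 'r, 'u) fm" and xs ys
  assumes pf: "partitioned_formula L \<phi> xs ys" and ne: "univ U \<noteq> {}"
begin

lemma relates_Neg:
  assumes "a \<in> tuples (univ U) (length xs)" "b \<in> tuples (univ U) (length ys)"
  shows "holds U (inst xs a (Neg (inst ys b \<phi>))) \<longleftrightarrow> \<not> relates U \<phi> xs ys a b"
proof (rule holds_inst_Neg[OF _ _ ne assms(1)])
  show "fv (inst ys b \<phi>) \<subseteq> set xs"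
    using assms(2) pf by (auto simp: fv_inst tuples_def partitioned_formula_def formulas_def)
  show "distinct xs" using pf by (simp add: partitioned_formula_def)
qed

text \<open>
  A maximal consistent set decides \<open>\<psi>\<close>: if neither \<open>\<psi>\<close> nor its negation could be added, then two finite
  parts of \<open>q\<close> would refute one each, but a tuple satisfying both parts satisfies \<open>\<psi>\<close> or its negation.
\<close>

lemma phi_type_Neg_iff:
  assumes q: "q \<in> phi_types U \<phi> xs ys" and b: "b \<in> tuples (univ U) (length ys)"
  shows "Neg (inst ys b \<phi>) \<in> q \<longleftrightarrow> inst ys b \<phi> \<notin> q"
proof
  let ?\<psi> = "inst ys b \<phi>"
  have con: "consistent U xs q" and sub: "q \<subseteq> phi_formulas U \<phi> ys"
    and max: "\<And>q'. q \<subseteq> q' \<Longrightarrow> q' \<subseteq> phi_formulas U \<phi> ys \<Longrightarrow> consistent U xs q' \<Longrightarrow> q' = q"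
    using q by (auto simp: phi_types_def)
  {
    assume "Neg ?\<psi> \<in> q"
    then show "?\<psi> \<notin> q"
      using consistentD[OF con, of "{?\<psi>, Neg ?\<psi>}"] relates_Neg[OF _ b] by auto
  next
    assume no: "?\<psi> \<notin> q"
    show "Neg ?\<psi> \<in> q"
    proof (rule ccontr)
      assume no': "Neg ?\<psi> \<notin> q"
      have refuted: "\<not> consistent U xs (insert \<eta> q)" if "\<eta> = ?\<psi> \<or> \<eta> = Neg ?\<psi>" for \<eta>
      proof
        assume con': "consistent U xs (insert \<eta> q)"
        have "insert \<eta> q \<subseteq> phi_formulas U \<phi> ys"
          using sub that b by (auto simp: phi_formulas_def)
        from max[OF subset_insertI this con'] show False using that no no' by auto
      qed
      obtain F where F: "F \<subseteq> insert ?\<psi> q" "finite F"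
          "\<And>a. a \<in> tuples (univ U) (length xs) \<Longrightarrow> \<exists>\<theta>\<in>F. \<not> holds U (inst xs a \<theta>)"
        by (rule inconsistentE[OF refuted[OF disjI1[OF refl]]]) (rule that)
      obtain G where G: "G \<subseteq> insert (Neg ?\<psi>) q" "finite G"
          "\<And>a. a \<in> tuples (univ U) (length xs) \<Longrightarrow> \<exists>\<theta>\<in>G. \<not> holds U (inst xs a \<theta>)"
        by (rule inconsistentE[OF refuted[OF disjI2[OF refl]]]) (rule that)
      let ?H = "(F - {?\<psi>}) \<union> (G - {Neg ?\<psi>})"
      have H: "?H \<subseteq> q" "finite ?H" using F(1,2) G(1,2) by auto
      obtain a where a: "a \<in> tuples (univ U) (length xs)" "\<forall>\<theta>\<in>?H. holds U (inst xs a \<theta>)"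
        by (rule bexE[OF consistentD[OF con H]])
      have "\<not> holds U (inst xs a ?\<psi>)"
      proof -
        obtain \<theta> where \<theta>: "\<theta> \<in> F" "\<not> holds U (inst xs a \<theta>)" by (rule bexE[OF F(3)[OF a(1)]])
        have "\<theta> \<notin> ?H" using \<theta>(2) by (rule contrapos_nn) (rule bspec[OF a(2)])
        then show ?thesis using \<theta> by simp
      qed
      moreover have "\<not> holds U (inst xs a (Neg ?\<psi>))"
      proof -
        obtain \<theta> where \<theta>: "\<theta> \<in> G" "\<not> holds U (inst xs a \<theta>)" by (rule bexE[OF G(3)[OF a(1)]])
        have "\<theta> \<notin> ?H" using \<theta>(2) by (rule contrapos_nn) (rule bspec[OF a(2)])
        then show ?thesis using \<theta> by simp
      qed
      ultimately show False using relates_Neg[OF a(1) b] by simp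
    qed
  }
qed

lemma phi_type_finitely_realized:
  assumes q: "q \<in> phi_types U \<phi> xs ys" and B: "finite B" "B \<subseteq> tuples (univ U) (length ys)"
  shows "\<exists>a\<in>tuples (univ U) (length xs). \<forall>b\<in>B. relates U \<phi> xs ys a b = (inst ys b \<phi> \<in> q)"
proof -
  let ?l = "\<lambda>b. if inst ys b \<phi> \<in> q then inst ys b \<phi> else Neg (inst ys b \<phi>)"
  have "?l ` B \<subseteq> q" using phi_type_Neg_iff[OF q] B(2) by auto
  then obtain a where a: "a \<in> tuples (univ U) (length xs)" "\<forall>\<theta>\<in>?l ` B. holds U (inst xs a \<theta>)"
    using consistentD[of U xs q "?l ` B"] q B(1) by (auto simp: phi_types_def)
  have "relates U \<phi> xs ys a b = (inst ys b \<phi> \<in> q)" if "b \<in> B" for b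
  proof -
    have "holds U (inst xs a (?l b))" by (rule bspec[OF a(2) imageI[OF that]])
    then show ?thesis using relates_Neg[OF a(1) subsetD[OF B(2) that]] by (cases "inst ys b \<phi> \<in> q") auto
  qed
  then show ?thesis using a(1) by blast
qed

lemma phi_type_entails_iff:
  assumes q: "q \<in> phi_types U \<phi> xs ys" and b: "b \<in> tuples (univ U) (length ys)"
  shows "entails U xs q (inst ys b \<phi>) \<longleftrightarrow> inst ys b \<phi> \<in> q"
proof
  assume "entails U xs q (inst ys b \<phi>)"
  then obtain F where F: "F \<subseteq> q" "finite F" "\<forall>a\<in>tuples (univ U) (length xs).
      (\<forall>\<theta>\<in>F. holds U (inst xs a \<theta>)) \<longrightarrow> relates U \<phi> xs ys a b"
    unfolding entails_def by blast
  show "inst ys b \<phi> \<in> q"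
  proof (rule ccontr)
    assume "inst ys b \<phi> \<notin> q"
    then have "insert (Neg (inst ys b \<phi>)) F \<subseteq> q" using F(1) phi_type_Neg_iff[OF q b] by auto
    then obtain a where "a \<in> tuples (univ U) (length xs)"
      "\<forall>\<theta>\<in>insert (Neg (inst ys b \<phi>)) F. holds U (inst xs a \<theta>)"
      using consistentD[of U xs q "insert (Neg (inst ys b \<phi>)) F"] q F(2) by (auto simp: phi_types_def)
    then show False using F(3) relates_Neg[OF _ b] by auto
  qed
next
  assume "inst ys b \<phi> \<in> q"
  then show "entails U xs q (inst ys b \<phi>)"
    unfolding entails_def by (intro exI[of _ "{inst ys b \<phi>}"]) auto
qed

lemma topspace_phi_type_space: "topspace (phi_type_space U \<phi> xs ys) = phi_types U \<phi> xs ys"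
proof -
  obtain c where "c \<in> univ U" using ne by blast
  then have "replicate (length ys) c \<in> tuples (univ U) (length ys)" by (auto simp: tuples_def)
  then show ?thesis using phi_type_Neg_iff unfolding phi_type_space_def by auto
qed

text \<open>
  The topology is that of pointwise convergence of the truth values of \<open>\<phi>(x;b)\<close>. This lemma and the next one
  are the two consequences needed: a criterion for limits, and approximation of points of the closure
  on finite sets.
\<close>

lemma limitin_phi_type_space:
  assumes q: "\<forall>\<^sub>F i in F. q i \<in> phi_types U \<phi> xs ys" and p: "p \<in> phi_types U \<phi> xs ys"
    and lim: "\<And>b. b \<in> tuples (univ U) (length ys) \<Longrightarrow>
      \<forall>\<^sub>F i in F. (inst ys b \<phi> \<in> q i) = (inst ys b \<phi> \<in> p)"
  shows "limitin (phi_type_space U \<phi> xs ys) q p F"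
  unfolding phi_type_space_def
proof (rule limitin_topology_generated_by)
  show "p \<in> \<Union>(\<Union>b\<in>tuples (univ U) (length ys). {{p \<in> phi_types U \<phi> xs ys. inst ys b \<phi> \<in> p},
      {p \<in> phi_types U \<phi> xs ys. Neg (inst ys b \<phi>) \<in> p}})"
    using p topspace_phi_type_space unfolding phi_type_space_def topology_generated_by_topspace by simp
next
  fix S assume "p \<in> S" and "S \<in> (\<Union>b\<in>tuples (univ U) (length ys). {{p \<in> phi_types U \<phi> xs ys. inst ys b \<phi> \<in> p},
      {p \<in> phi_types U \<phi> xs ys. Neg (inst ys b \<phi>) \<in> p}})"
  then obtain b where b: "b \<in> tuples (univ U) (length ys)"
    and S: "S = {p \<in> phi_types U \<phi> xs ys. inst ys b \<phi> \<in> p} \<or> S = {p \<in> phi_types U \<phi> xs ys. Neg (inst ys b \<phi>) \<in> p}"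
    by blast
  have S': "r \<in> S \<longleftrightarrow> (inst ys b \<phi> \<in> r) = (inst ys b \<phi> \<in> p)" if "r \<in> phi_types U \<phi> xs ys" for r
    using S \<open>p \<in> S\<close> that p phi_type_Neg_iff[OF _ b] by auto
  show "\<forall>\<^sub>F i in F. q i \<in> S"
    using q lim[OF b] by eventually_elim (simp add: S')
qed

lemma closure_of_phi_types_finite_agreement:
  assumes p: "p \<in> (subtopology (phi_type_space U \<phi> xs ys) I) closure_of Z" and Z: "Z \<subseteq> phi_types U \<phi> xs ys"
    and B: "finite B" "B \<subseteq> tuples (univ U) (length ys)"
  shows "\<exists>q\<in>Z. \<forall>b\<in>B. (inst ys b \<phi> \<in> q) = (inst ys b \<phi> \<in> p)"
proof -
  let ?T = "phi_type_space U \<phi> xs ys"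
  have pI: "p \<in> phi_types U \<phi> xs ys" "p \<in> I"
    using p by (auto simp: in_closure_of topspace_phi_type_space)
  let ?S = "\<lambda>b. {q \<in> phi_types U \<phi> xs ys. (inst ys b \<phi> \<in> q) = (inst ys b \<phi> \<in> p)}"
  have "openin ?T (?S b)" if b: "b \<in> B" for b
  proof -
    have "?S b = {q \<in> phi_types U \<phi> xs ys. inst ys b \<phi> \<in> q} \<or>
        ?S b = {q \<in> phi_types U \<phi> xs ys. Neg (inst ys b \<phi>) \<in> q}"
      using phi_type_Neg_iff b B(2) by blast
    then show ?thesis
      unfolding phi_type_space_def using b B(2) by (intro topology_generated_by_Basis) blast
  qed
  then have "openin ?T ((\<Inter>b\<in>B. ?S b) \<inter> topspace ?T)" by (intro openin_INT[OF B(1)])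
  then have "openin (subtopology ?T I) ((\<Inter>b\<in>B. ?S b) \<inter> topspace ?T \<inter> I)"
    by (auto simp: openin_subtopology)
  moreover have "p \<in> (\<Inter>b\<in>B. ?S b) \<inter> topspace ?T \<inter> I"
    using pI by (simp add: topspace_phi_type_space)
  ultimately obtain q where "q \<in> Z" "q \<in> (\<Inter>b\<in>B. ?S b) \<inter> topspace ?T \<inter> I"
    using p unfolding in_closure_of by meson
  then show ?thesis by (intro bexI[of _ q]) auto
qed

end


section \<open>Approximation of invariant types\<close>

theorem proposition2p12:
  fixes \<kappa> :: "'k rel" and \<mu> :: "'m rel"
    and L :: "('f, 'r) lang"
    and T :: "('f, 'r, 'u) fm set"
    and U M :: "('f, 'r, 'u) struct"
    and \<phi> :: "('f, 'r, 'u) fm"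
    and xs ys :: "nat list"
    and Z :: "('f, 'r, 'u) fm set set"
    and p :: "('f, 'r, 'u) fm set"
  assumes "Cinfinite \<kappa>"
    and "complete_theory L T"
    and "monster_model L T \<mu> U"
    and "elementary_submodel L M U" and "is_model L M T" and "|univ M| <o \<mu>"
    and "|univ M| \<le>o \<kappa>" and "|T| \<le>o \<kappa>"
    and "partitioned_formula L \<phi> xs ys"
    and "NIP U \<phi> xs ys"
    and "Z \<subseteq> invariant_phi_types L U M \<phi> xs ys"
    and "p \<in> invariant_phi_type_space L U M \<phi> xs ys closure_of Z"
  shows "\<exists>q :: 'k set \<Rightarrow> ('f, 'r, 'u) fm set.
           (\<forall>i\<in>Fpow (Field \<kappa>). q i \<in> Z) \<and>
           limitin (invariant_phi_type_space L U M \<phi> xs ys) q p (fin_filter \<kappa>)"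
proof -
  let ?Y = "tuples (univ U) (length ys)" and ?\<C> = "definable_sets L U (univ M) ys"
  have ne: "univ U \<noteq> {}" and sat: "saturated L \<mu> U" and "Card_order \<mu>" "|T| <o \<mu>"
    using assms(3) by (auto simp: monster_model_def is_model_def is_structure_def)
  have "natLeq \<le>o |T|"
    using complete_theory_infinite[OF assms(2)] card_of_nat ordIso_symmetric ordIso_ordLeq_trans by blast
  then have nat: "natLeq <o \<mu>" using \<open>|T| <o \<mu>\<close> by (rule ordLeq_ordLess_trans)
  then have \<mu>: "Cinfinite \<mu>"
    using \<open>Card_order \<mu>\<close> cinfinite_mono[OF ordLess_imp_ordLeq natLeq_cinfinite] by blast
  have MU: "univ M \<subseteq> univ U" using assms(4) by (simp add: elementary_submodel_def)
  note pf = assms(9)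
  interpret saturated_relation "tuples (univ U) (length xs)" ?Y "relates U \<phi> xs ys" ?\<C>
    by (rule saturated_relation_monster[OF sat ne \<mu> nat MU assms(6) pf assms(10)])
  have "|formulas L (univ M) (set ys)| \<le>o \<kappa>"
    using card_funs_le_theory[OF assms(2)] card_rels_le_theory[OF assms(2)] assms(7,8)
    by (intro card_formulas_bound[OF assms(1)]) (auto intro: ordLeq_transitive)
  then have card: "|?\<C>| \<le>o \<kappa>" unfolding definable_sets_def by (rule card_image_bound)
  have Z: "q \<in> phi_types U \<phi> xs ys" if "q \<in> Z" for q
    using assms(11) that by (auto simp: invariant_phi_types_def)
  have tp: "tp L U (univ M) ys b = tp L U (univ M) ys b'"
    if b: "b \<in> ?Y" "b' \<in> ?Y" and same: "same_type b b'" for b b'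
  proof -
    have "holds U (inst ys b \<theta>) \<longleftrightarrow> holds U (inst ys b' \<theta>)" if "\<theta> \<in> formulas L (univ M) (set ys)" for \<theta>
    proof -
      have "{b \<in> ?Y. holds U (inst ys b \<theta>)} \<in> ?\<C>" using that by (auto simp: definable_sets_def)
      from bspec[OF same[unfolded same_type_def] this] show ?thesis using b by simp
    qed
    then show ?thesis by (auto simp: tp_def)
  qed
  have inv: "(inst ys b \<phi> \<in> q) = (inst ys b' \<phi> \<in> q)"
    if q: "q \<in> Z" and b: "b \<in> ?Y" "b' \<in> ?Y" "same_type b b'" for q b b'
  proof -
    have "\<forall>b\<in>?Y. \<forall>b'\<in>?Y. tp L U (univ M) ys b = tp L U (univ M) ys b' \<longrightarrow>
        (entails U xs q (inst ys b \<phi>) \<longleftrightarrow> entails U xs q (inst ys b' \<phi>))"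
      using subsetD[OF assms(11) q] unfolding invariant_phi_types_def by (elim CollectE conjE)
    from bspec[OF bspec[OF this b(1)] b(2), THEN mp, OF tp[OF b]]
    have "entails U xs q (inst ys b \<phi>) \<longleftrightarrow> entails U xs q (inst ys b' \<phi>)" .
    then show ?thesis using phi_type_entails_iff[OF pf ne Z[OF q]] b by simp
  qed
  have "\<exists>r :: 'k set \<Rightarrow> ('f, 'r, 'u) fm set. (\<forall>i\<in>Fpow (Field \<kappa>). r i \<in> Z) \<and>
      (\<forall>b\<in>?Y. \<forall>\<^sub>F i in fin_filter \<kappa>. (inst ys b \<phi> \<in> r i) = (inst ys b \<phi> \<in> p))"
  proof (rule approximating_family[OF assms(1) card, where val = "\<lambda>q b. inst ys b \<phi> \<in> q"])
    show "\<exists>a\<in>tuples (univ U) (length xs). \<forall>b\<in>B. relates U \<phi> xs ys a b = (inst ys b \<phi> \<in> q)"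
      if "q \<in> Z" "finite B" "B \<subseteq> ?Y" for q B
      using phi_type_finitely_realized[OF pf ne Z] that by blast
    show "\<exists>q\<in>Z. \<forall>b\<in>B. (inst ys b \<phi> \<in> q) = (inst ys b \<phi> \<in> p)" if "finite B" "B \<subseteq> ?Y" for B
      using closure_of_phi_types_finite_agreement[OF pf ne, of p _ Z B] assms(12) Z that
      unfolding invariant_phi_type_space_def by blast
  qed (rule inv)
  then obtain r :: "'k set \<Rightarrow> ('f, 'r, 'u) fm set" where r: "\<And>i. i \<in> Fpow (Field \<kappa>) \<Longrightarrow> r i \<in> Z"
    "\<And>b. b \<in> ?Y \<Longrightarrow> \<forall>\<^sub>F i in fin_filter \<kappa>. (inst ys b \<phi> \<in> r i) = (inst ys b \<phi> \<in> p)"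
    by blast
  have rZ: "\<forall>\<^sub>F i in fin_filter \<kappa>. r i \<in> Z"
    by (rule eventually_finite_subsets_at_top_weakI) (use r(1) in \<open>auto simp: Fpow_def\<close>)
  have p: "p \<in> invariant_phi_types L U M \<phi> xs ys" "p \<in> phi_types U \<phi> xs ys"
    using assms(12) topspace_phi_type_space[OF pf ne]
    by (auto simp: in_closure_of invariant_phi_type_space_def)
  have "limitin (phi_type_space U \<phi> xs ys) r p (fin_filter \<kappa>)"
    by (rule limitin_phi_type_space[OF pf ne _ p(2) r(2)]) (use rZ Z in \<open>auto elim: eventually_mono\<close>)
  then have "limitin (invariant_phi_type_space L U M \<phi> xs ys) r p (fin_filter \<kappa>)"
    unfolding invariant_phi_type_space_def limitin_subtopology
    using p(1) eventually_mono[OF rZ subsetD[OF assms(11)]] by simp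
  then show ?thesis using r(1) by blast
qed

end
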